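(* Let $n\ge 2$, let $k$ be an infinite field, and let $f,g\in R=k[x_1,\ldots,x_n,x_{n+1}]$ be relatively prime forms of respective degrees $d-1$ and $d\ge 2$, such that $g\in(x_1,\ldots,x_n)R$. Set $I:=(x_1f,\ldots,x_nf,g)$. Then the minimal graded free resolution of $R/I$ is $$0\to R(-(n+d-1))\to\cdots\to R(-(d+2))^{\binom n3}\to R(-(d+1))^{\binom n2}\oplus R(-(2d-1))\stackrel{\psi}{\longrightarrow}R(-d)^{n+1}\to R,$$ where: (a) the syzygy matrix $\psi$ has the form $$\psi=\left(\begin{array}{ccc|c}&&&-q_1\\&\mathcal{K}&&\vdots\\&&&-q_n\\\hline 0&\cdots&0&f\end{array}\right)$$ with $\mathcal{K}$ the first Koszul matrix of $x_1,\ldots,x_n$ and $g=q_1x_1+\cdots+q_nx_n$; (b) the $n-2$ tail terms of the resolution are the $n-2$ tail terms of the Koszul complex of $\{x_1,\ldots,x_n\}$ shifted by $d-1$.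
   Context: $R$ is standard graded. The first Koszul matrix $\mathcal{K}$ of $x_1,\ldots,x_n$ is the $n\times\binom n2$ matrix whose columns are the Koszul syzygies $x_je_i-x_ie_j$ $(1\le i<j\le n)$. The forms $q_1,\ldots,q_n\in R$ of degree $d-1$ are the coefficients in an expression $g=q_1x_1+\cdots+q_nx_n$, which exists since $g\in(x_1,\ldots,x_n)R$. The matrix $\psi$ is written with respect to the generators $x_1f,\ldots,x_nf,g$ of $I$. The "tail terms" in (b) are the terms in homological degrees $3,\ldots,n$, where $R$ sits in homological degree $0$; thus for $3\le i\le n$ the term in homological degree $i$ is $R(-(d-1+i))^{\binom ni}$ (for $n=2$ there are none and the resolution starts with $0\to R(-(d+1))\oplus R(-(2d-1))$). *)

theory Defs
  imports
    "HOL-Library.Poly_Mapping"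
    "HOL-Library.Multiset"
    "HOL-Library.FuncSet"
    "HOL-Algebra.Ideal"
    "HOL-Algebra.Divisibility"
begin

section \<open>The standard graded polynomial ring\<close>

text \<open>
  Polynomials live in the type of polynomials in the variables \<open>x\<^sub>0, x\<^sub>1, x\<^sub>2, \<dots>\<close>; the ring
  \<open>k[x\<^sub>1, \<dots>, x\<^sub>m]\<close> is the subring of those in which only \<open>x\<^sub>1, \<dots>, x\<^sub>m\<close> occur.
\<close>

type_synonym 'k mpoly = "(nat \<Rightarrow>\<^sub>0 nat) \<Rightarrow>\<^sub>0 'k"

definition var :: "nat \<Rightarrow> 'k::field mpoly"
  where "var i = Poly_Mapping.single (Poly_Mapping.single i 1) 1"

definition poly_ring :: "nat \<Rightarrow> 'k::field mpoly ring"
  where "poly_ring m =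
    \<lparr>carrier = {p. \<forall>t\<in>Poly_Mapping.keys p. Poly_Mapping.keys t \<subseteq> {1..m}},
     monoid.mult = (*), one = 1, zero = 0, add = (+)\<rparr>"

definition mon_degree :: "(nat \<Rightarrow>\<^sub>0 nat) \<Rightarrow> nat"
  where "mon_degree t = (\<Sum>i\<in>Poly_Mapping.keys t. Poly_Mapping.lookup t i)"

text \<open>The zero polynomial is a form of every degree.\<close>

definition form :: "nat \<Rightarrow> 'k::field mpoly \<Rightarrow> bool"
  where "form e p \<longleftrightarrow> (\<forall>t\<in>Poly_Mapping.keys p. mon_degree t = e)"

definition relatively_prime :: "('a, 'b) monoid_scheme \<Rightarrow> 'a \<Rightarrow> 'a \<Rightarrow> bool"
  where "relatively_prime R a b \<longleftrightarrow>
    (\<forall>c\<in>carrier R. c divides\<^bsub>R\<^esub> a \<longrightarrow> c divides\<^bsub>R\<^esub> b \<longrightarrow> c \<in> Units R)"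


section \<open>Graded complexes of free modules\<close>

text \<open>
  A complex \<open>\<dots> \<rightarrow> F\<^sub>2 \<rightarrow> F\<^sub>1 \<rightarrow> F\<^sub>0\<close> of graded free modules is given by bases and matrices:
  \<open>gens C i\<close> indexes a basis of \<open>F\<^sub>i\<close>, the basis element \<open>b\<close> of \<open>F\<^sub>i\<close> has degree
  \<open>gdeg C i b\<close> (so it spans a summand \<open>R(-gdeg C i b)\<close>), and \<open>dmat C i a b\<close> is the entry in
  row \<open>a \<in> gens C (i - 1)\<close> and column \<open>b \<in> gens C i\<close> of the differential
  \<open>F\<^sub>i \<rightarrow> F\<^bsub>i-1\<^esub>\<close>, \<open>i \<ge> 1\<close>.
\<close>

record ('b, 'r) free_complex =
  gens :: "nat \<Rightarrow> 'b set"
  gdeg :: "nat \<Rightarrow> 'b \<Rightarrow> nat"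
  dmat :: "nat \<Rightarrow> 'b \<Rightarrow> 'b \<Rightarrow> 'r"

definition free_mod :: "nat \<Rightarrow> ('b, 'k::field mpoly) free_complex \<Rightarrow> nat \<Rightarrow> ('b \<Rightarrow> 'k mpoly) set"
  where "free_mod m C i = gens C i \<rightarrow>\<^sub>E carrier (poly_ring m)"

definition dmap :: "('b, 'k::field mpoly) free_complex \<Rightarrow> nat \<Rightarrow> ('b \<Rightarrow> 'k mpoly) \<Rightarrow> ('b \<Rightarrow> 'k mpoly)"
  where "dmap C i v = (\<lambda>a\<in>gens C (i - 1). \<Sum>b\<in>gens C i. dmat C i a b * v b)"

definition dker :: "nat \<Rightarrow> ('b, 'k::field mpoly) free_complex \<Rightarrow> nat \<Rightarrow> ('b \<Rightarrow> 'k mpoly) set"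
  where "dker m C i = {v \<in> free_mod m C i. dmap C i v = (\<lambda>a\<in>gens C (i - 1). 0)}"

text \<open>The degrees of the basis elements of \<open>F\<^sub>i\<close>: it is \<open>\<Oplus> R(-j)\<close>, \<open>j\<close> ranging over this multiset.\<close>

definition gen_degrees :: "('b, 'k::field mpoly) free_complex \<Rightarrow> nat \<Rightarrow> nat multiset"
  where "gen_degrees C i = image_mset (gdeg C i) (mset_set (gens C i))"

text \<open>The differentials are homogeneous of degree 0.\<close>

definition graded_free_complex :: "nat \<Rightarrow> ('b, 'k::field mpoly) free_complex \<Rightarrow> bool"
  where "graded_free_complex m C \<longleftrightarrow>
    (\<forall>i. finite (gens C i)) \<and>
    (\<forall>i\<ge>1. \<forall>a\<in>gens C (i - 1). \<forall>b\<in>gens C i.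
       dmat C i a b \<in> carrier (poly_ring m) \<and>
       (dmat C i a b = 0 \<or>
        gdeg C (i - 1) a \<le> gdeg C i b \<and> form (gdeg C i b - gdeg C (i - 1) a) (dmat C i a b)))"

text \<open>
  For \<open>R = k[x\<^sub>1, \<dots>, x\<^sub>m]\<close> and an ideal \<open>I\<close> of \<open>R\<close>: \<open>F\<^sub>0 = R\<close> (in degree 0), augmented by the
  canonical map \<open>R \<rightarrow> R/I\<close>, whose kernel is \<open>I\<close>. Minimality says that the differentials map
  \<open>F\<^sub>i\<close> into \<open>(x\<^sub>1, \<dots>, x\<^sub>m) F\<^bsub>i-1\<^esub>\<close>.
\<close>

definition minimal_graded_free_resolution ::
    "nat \<Rightarrow> 'k::field mpoly set \<Rightarrow> ('b, 'k mpoly) free_complex \<Rightarrow> bool"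
  where "minimal_graded_free_resolution m I C \<longleftrightarrow>
    graded_free_complex m C \<and>
    (\<exists>e. gens C 0 = {e} \<and> gdeg C 0 e = 0 \<and> (\<lambda>v. dmap C 1 v e) ` free_mod m C 1 = I) \<and>
    (\<forall>i\<ge>1. dker m C i = dmap C (i + 1) ` free_mod m C (i + 1)) \<and>
    (\<forall>i\<ge>1. \<forall>a\<in>gens C (i - 1). \<forall>b\<in>gens C i.
       dmat C i a b \<in> Idl\<^bsub>poly_ring m\<^esub> (var ` {1..m}))"


section \<open>The Koszul complex\<close>

text \<open>
  The basis element \<open>e\<^sub>S\<close> is indexed by \<open>S \<subseteq> {1, \<dots>, n}\<close> and
  \<open>\<partial> e\<^sub>S = \<Sum>i\<in>S. (-1)^card {j\<in>S. i < j} x\<^sub>i e\<^bsub>S - {i}\<^esub>\<close>. The sign counts the larger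
  indices, so that \<open>\<partial> e\<^bsub>{i,j}\<^esub> = x\<^sub>j e\<^sub>i - x\<^sub>i e\<^sub>j\<close> for \<open>i < j\<close>. In \<open>koszul_mat T S\<close> the sum
  has at most one term.
\<close>

definition koszul_mat :: "nat set \<Rightarrow> nat set \<Rightarrow> 'k::field mpoly"
  where "koszul_mat T S = (\<Sum>i | i \<in> S \<and> T = S - {i}. (-1) ^ card {j\<in>S. i < j} * var i)"

definition koszul :: "nat \<Rightarrow> (nat set, 'k::field mpoly) free_complex"
  where "koszul n =
    \<lparr>gens = (\<lambda>i. {S. S \<subseteq> {1..n} \<and> card S = i}),
     gdeg = (\<lambda>i S. i),
     dmat = (\<lambda>i. koszul_mat)\<rparr>"


section \<open>The complex resolving the quotient by \<open>(x\<^sub>1 f, \<dots>, x\<^sub>n f, g)\<close>\<close>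

definition is_expression :: "nat \<Rightarrow> nat \<Rightarrow> 'k::field mpoly \<Rightarrow> (nat \<Rightarrow> 'k mpoly) \<Rightarrow> bool"
  where "is_expression n d g q \<longleftrightarrow>
    (\<forall>i\<in>{1..n}. q i \<in> carrier (poly_ring (n + 1)) \<and> form (d - 1) (q i)) \<and>
    g = (\<Sum>i=1..n. q i * var i)"

text \<open>
  \<open>Some S\<close> are the basis elements coming from the Koszul complex on \<open>x\<^sub>1, \<dots>, x\<^sub>n\<close>; \<open>None\<close> is the
  extra basis element in homological degree 1 (mapping to \<open>g\<close>), resp. 2 (the last column
  of \<open>\<psi>\<close>).
\<close>

definition gen_row :: "'k::field mpoly \<Rightarrow> 'k mpoly \<Rightarrow> nat set option \<Rightarrow> nat set option \<Rightarrow> 'k mpoly"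
  where "gen_row f g a b =
    (case b of Some S \<Rightarrow> var (the_elem S) * f | None \<Rightarrow> g)"

definition psi :: "'k::field mpoly \<Rightarrow> (nat \<Rightarrow> 'k mpoly) \<Rightarrow> nat set option \<Rightarrow> nat set option \<Rightarrow> 'k mpoly"
  where "psi f q a b =
    (case (a, b) of
       (Some T, Some S) \<Rightarrow> koszul_mat T S
     | (Some T, None) \<Rightarrow> - q (the_elem T)
     | (None, Some S) \<Rightarrow> 0
     | (None, None) \<Rightarrow> f)"

text \<open>In homological degree 3 the row \<open>None\<close> is present and its entries are 0.\<close>

definition tail_mat :: "nat set option \<Rightarrow> nat set option \<Rightarrow> 'k::field mpoly"
  where "tail_mat a b =
    (case (a, b) of (Some T, Some S) \<Rightarrow> koszul_mat T S | _ \<Rightarrow> 0)"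

definition res_complex ::
    "nat \<Rightarrow> nat \<Rightarrow> 'k::field mpoly \<Rightarrow> 'k mpoly \<Rightarrow> (nat \<Rightarrow> 'k mpoly) \<Rightarrow> (nat set option, 'k mpoly) free_complex"
  where "res_complex n d f g q =
    \<lparr>gens = (\<lambda>i. Some ` {S. S \<subseteq> {1..n} \<and> card S = i} \<union> (if i \<in> {1, 2} then {None} else {})),
     gdeg = (\<lambda>i b. case b of
         Some S \<Rightarrow> if i = 0 then 0 else d - 1 + i
       | None \<Rightarrow> if i = 1 then d else 2 * d - 1),
     dmat = (\<lambda>i. if i = 1 then gen_row f g else if i = 2 then psi f q else tail_mat)\<rparr>"

end

theory Submission
  imports Defs "HOL-Computational_Algebra.Polynomial"
begin

text \<open>
  If \<open>(v\<^sub>1, \<dots>, v\<^sub>n, v\<^sub>0)\<close> is a syzygy of \<open>(x\<^sub>1 f, \<dots>, x\<^sub>n f, g)\<close>, then \<open>f\<close> divides \<open>v\<^sub>0 g\<close>, hence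
  \<open>v\<^sub>0 = f w\<close> as \<open>f\<close> and \<open>g\<close> are relatively prime. Cancelling \<open>f\<close> shows that the \<open>v\<^sub>i + w q\<^sub>i\<close> form a
  syzygy of \<open>x\<^sub>1, \<dots>, x\<^sub>n\<close>, which is a combination of Koszul syzygies. So \<open>\<psi>\<close> presents the ideal; its
  last column has the nonzero last entry \<open>f\<close>, all the others have last entry 0, so the kernel of \<open>\<psi>\<close>
  is that of the Koszul matrix, and exactness of the Koszul complex finishes the proof.

  Exactness of the Koszul complex is proved by induction on the number of variables (mapping cone).
  That relatively prime polynomials satisfy Euclid's lemma, i.e. unique factorization, is also
  proved by induction on the number of variables.
\<close>

section \<open>Primes in polynomial extensions\<close>

text \<open>All rings \<open>k[x_1, ..., x_m]\<close> are subsets of one type with infinitely many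
  variables, so that the induction on \<open>m\<close> can be about sets. Divisibility and
  irreducibility are always those of the whole type. This is harmless because each of the subrings
  contains every factor of each of its nonzero elements; hence the recurring concern with nonzero
  products and with quotients lying in the subring. Fraction fields, contents and gcds are avoided
  in passing from \<open>A\<close> to A[x]. Pseudo-division introduces nonzero constants from
  \<open>A\<close>, and these are removed again by induction on their irreducible factors, each of
  which is prime in A[x] by Gauss's argument. On the Koszul side the coefficient ring stays fixed
  while the variables enter the complex one by one. Since the signs count the larger indices, a new
  largest index enters with sign +1 and changes the sign of everything on the sets containing it,
  which is exactly the differential of a mapping cone.\<close>

abbreviation irred :: "'a::comm_semiring_1 \<Rightarrow> bool"
  where "irred \<equiv> Factorial_Ring.irreducible"

text \<open>An abstract total degree. Additivity, with measure 0 forcing a unit, is what makes the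
  splitting off of factors terminate.\<close>

locale additive_measure =
  fixes \<mu> :: "'a::idom \<Rightarrow> nat"
  assumes mu_mult: "a \<noteq> 0 \<Longrightarrow> b \<noteq> 0 \<Longrightarrow> \<mu> (a * b) = \<mu> a + \<mu> b"
    and mu_0_unit: "a \<noteq> 0 \<Longrightarrow> \<mu> a = 0 \<Longrightarrow> a dvd 1"
begin

lemma mult_unit_dvd:
  fixes s :: 'a
  assumes "s dvd 1"
  shows "s * r dvd r"
  using assms by (metis dvd_refl mult_dvd_mono mult_1)

text \<open>A nonunit divisor of \<open>c\<close> of least measure works: if it were a product of
  two nonunits, the first would be a candidate as well, so the second would have measure 0 and be a
  unit.\<close>

lemma irred_factor_exists:
  fixes c :: 'a
  assumes "c \<noteq> 0" "\<not> c dvd 1"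
  shows "\<exists>p. irred p \<and> p dvd c"
proof -
  define Q where "Q = (\<lambda>p. p dvd c \<and> \<not> p dvd 1)"
  have "Q c" using assms by (simp add: Q_def)
  then obtain p where p: "Q p" and min: "\<And>a. Q a \<Longrightarrow> \<mu> p \<le> \<mu> a"
    using ex_has_least_nat[of Q c \<mu>] by blast
  have "p \<noteq> 0" using p assms by (auto simp: Q_def)
  have "irred p"
  proof (rule Factorial_Ring.irreducibleI)
    show "p \<noteq> 0" by fact
    show "\<not> p dvd 1" using p by (simp add: Q_def)
    fix a b assume ab: "p = a * b"
    show "a dvd 1 \<or> b dvd 1"
    proof (rule ccontr)
      assume n: "\<not> (a dvd 1 \<or> b dvd 1)"
      have nz: "a \<noteq> 0" "b \<noteq> 0" using ab \<open>p \<noteq> 0\<close> by auto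
      have "Q a" using n p ab by (auto simp: Q_def dest: dvd_mult_left)
      hence "\<mu> p \<le> \<mu> a" by (rule min)
      hence "\<mu> b = 0" using mu_mult[OF nz] ab by simp
      thus False using mu_0_unit[OF nz(2)] n by blast
    qed
  qed
  thus ?thesis using p by (auto simp: Q_def)
qed

text \<open>Runs along a factorization of \<open>c\<close> into irreducibles without ever writing
  one down. The measure drops because an irreducible factor has positive measure.\<close>

lemma factor_induct [consumes 1, case_names unit mult]:
  fixes c :: 'a
  assumes "c \<noteq> 0"
    and unit: "\<And>c. c dvd 1 \<Longrightarrow> P c"
    and mult: "\<And>p c. irred p \<Longrightarrow> c \<noteq> 0 \<Longrightarrow> P c \<Longrightarrow> P (p * c)"
  shows "P c"
  using \<open>c \<noteq> 0\<close>
proof (induction "\<mu> c" arbitrary: c rule: less_induct)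
  case less
  show ?case
  proof (cases "c dvd 1")
    case False
    then obtain p c' where p: "irred p" and c: "c = p * c'"
      using irred_factor_exists less.prems by (meson dvdE)
    have nz: "p \<noteq> 0" "c' \<noteq> 0" using less.prems c by auto
    have "\<mu> p \<noteq> 0" using mu_0_unit[OF nz(1)] p by (auto simp: Factorial_Ring.irreducible_def)
    hence "P c'" using less.hyps mu_mult[OF nz] c nz by simp
    thus ?thesis using mult p nz c by blast
  qed (rule unit)
qed

end

text \<open>Both \<open>irred\<close> and \<open>dvd\<close> refer to the ambient type;
  \<open>A\<close> only restricts the elements. If \<open>A\<close> is a subring containing all
  factors of its nonzero elements, this agrees with the notions internal to
  \<open>A\<close>.\<close>

definition irred_are_prime_in :: "'a::comm_semiring_1 set \<Rightarrow> bool"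
  where "irred_are_prime_in A \<longleftrightarrow>
    (\<forall>p\<in>A. irred p \<longrightarrow> (\<forall>a\<in>A. \<forall>b\<in>A. p dvd a * b \<longrightarrow> p dvd a \<or> p dvd b))"

definition poly_over :: "'a::zero set \<Rightarrow> 'a poly set"
  where "poly_over A = {P. \<forall>i. coeff P i \<in> A}"

definition adjoin :: "'a::comm_semiring_0 set \<Rightarrow> 'a \<Rightarrow> 'a set"
  where "adjoin A x = (\<lambda>P. poly P x) ` poly_over A"

text \<open>By transcendence \<open>adjoin A x\<close> is a polynomial ring over \<open>A\<close>,
  so coefficients can be compared. The two factor assumptions bring quotients formed in the ambient
  type back into \<open>A\<close> and A[x].\<close>

locale factor_closed_extension = additive_measure \<mu> for \<mu> :: "'a::idom \<Rightarrow> nat" +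
  fixes A :: "'a set" and x :: 'a
  assumes A_0: "0 \<in> A" and A_1: "1 \<in> A"
    and A_diff: "a \<in> A \<Longrightarrow> b \<in> A \<Longrightarrow> a - b \<in> A"
    and A_mult: "a \<in> A \<Longrightarrow> b \<in> A \<Longrightarrow> a * b \<in> A"
    and A_factor: "a * b \<in> A \<Longrightarrow> a * b \<noteq> 0 \<Longrightarrow> a \<in> A"
    and adjoin_factor: "a * b \<in> adjoin A x \<Longrightarrow> a * b \<noteq> 0 \<Longrightarrow> a \<in> adjoin A x"
    and transcendental: "P \<in> poly_over A \<Longrightarrow> poly P x = 0 \<Longrightarrow> P = 0"
begin

section \<open>Closure properties of \<open>A\<close>, of polynomials over \<open>A\<close> and of
  A[x]\<close>

lemma A_add: "a \<in> A \<Longrightarrow> b \<in> A \<Longrightarrow> a + b \<in> A"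
  using A_diff[of a "0 - b"] A_diff[OF A_0, of b] by simp

lemma A_sum: "(\<And>i. i \<in> I \<Longrightarrow> h i \<in> A) \<Longrightarrow> sum h I \<in> A"
  by (induction I rule: infinite_finite_induct) (auto simp: A_0 A_add)

lemma poly_over_diff: "P \<in> poly_over A \<Longrightarrow> Q \<in> poly_over A \<Longrightarrow> P - Q \<in> poly_over A"
  by (simp add: poly_over_def A_diff)

lemma poly_over_add: "P \<in> poly_over A \<Longrightarrow> Q \<in> poly_over A \<Longrightarrow> P + Q \<in> poly_over A"
  by (simp add: poly_over_def A_add)

lemma poly_over_mult: "P \<in> poly_over A \<Longrightarrow> Q \<in> poly_over A \<Longrightarrow> P * Q \<in> poly_over A"
  by (simp add: poly_over_def coeff_mult A_sum A_mult)

lemma poly_over_smult: "c \<in> A \<Longrightarrow> Q \<in> poly_over A \<Longrightarrow> smult c Q \<in> poly_over A"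
  by (simp add: poly_over_def A_mult)

lemma poly_over_monom: "c \<in> A \<Longrightarrow> monom c k \<in> poly_over A"
  by (simp add: poly_over_def A_0)

lemma poly_over_0: "0 \<in> poly_over A"
  by (simp add: poly_over_def A_0)

lemma adjoin_mult: "a \<in> adjoin A x \<Longrightarrow> b \<in> adjoin A x \<Longrightarrow> a * b \<in> adjoin A x"
  by (auto simp: adjoin_def poly_over_mult intro!: image_eqI[where x = "_ * _"])

lemma A_adjoin: "a \<in> A \<Longrightarrow> a \<in> adjoin A x"
  using poly_over_monom[of a 0] by (auto simp: adjoin_def poly_monom intro!: image_eqI[where x = "monom a 0"])

lemma poly_eq_imp_eq:
  assumes "P \<in> poly_over A" "Q \<in> poly_over A" "poly P x = poly Q x"
  shows "P = Q"
  using transcendental[OF poly_over_diff[OF assms(1,2)]] assms(3) by simp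

text \<open>The quotient is again a polynomial in \<open>x\<close> over \<open>A\<close>, by closure
  under factors, and transcendence allows comparing coefficients.\<close>

lemma A_dvd_poly_imp_dvd_coeff:
  assumes "p \<in> A" "p \<noteq> 0" "P \<in> poly_over A" "p dvd poly P x"
  shows "p dvd coeff P i"
proof (cases "poly P x = 0")
  case True
  thus ?thesis using transcendental[OF assms(3)] by simp
next
  case False
  from assms(4) obtain w where w: "poly P x = w * p" by (metis dvdE mult.commute)
  have "w \<in> adjoin A x"
    by (rule adjoin_factor[of _ p]) (use w False assms(3) in \<open>auto simp: adjoin_def simp flip: w\<close>)
  then obtain W where W: "W \<in> poly_over A" "w = poly W x" by (auto simp: adjoin_def)
  have "P = smult p W"
    by (rule poly_eq_imp_eq) (use assms W w in \<open>auto simp: poly_over_smult\<close>)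
  thus ?thesis by simp
qed

text \<open>Gauss's lemma. If \<open>p\<close> divides neither factor, take in each the first
  coefficient not divisible by \<open>p\<close>. In the coefficient of the product at the sum of
  their indices, every other term is divisible by \<open>p\<close>.\<close>

lemma prime_lift:
  assumes p: "p \<in> A" "p \<noteq> 0"
    and prime: "\<And>a b. a \<in> A \<Longrightarrow> b \<in> A \<Longrightarrow> p dvd a * b \<Longrightarrow> p dvd a \<or> p dvd b"
    and "u \<in> adjoin A x" "v \<in> adjoin A x" "p dvd u * v"
  shows "p dvd u \<or> p dvd v"
proof (rule ccontr)
  assume n: "\<not> (p dvd u \<or> p dvd v)"
  obtain U V where U: "U \<in> poly_over A" "u = poly U x" and V: "V \<in> poly_over A" "v = poly V x"
    using assms by (auto simp: adjoin_def)
  have ex: "\<exists>i. \<not> p dvd coeff W i" if "\<not> p dvd poly W x" for W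
    using that by (auto simp: poly_altdef intro!: dvd_sum)
  define i where "i = (LEAST i. \<not> p dvd coeff U i)"
  define j where "j = (LEAST j. \<not> p dvd coeff V j)"
  have i': "p dvd coeff U k" if "k < i" for k
    using that not_less_Least unfolding i_def by blast
  have j': "p dvd coeff V k" if "k < j" for k
    using that not_less_Least unfolding j_def by blast
  have i0: "\<not> p dvd coeff U i" using LeastI_ex[OF ex[of U]] n U unfolding i_def by simp
  have j0: "\<not> p dvd coeff V j" using LeastI_ex[OF ex[of V]] n V unfolding j_def by simp
  have "p dvd coeff (U * V) (i + j)"
    by (rule A_dvd_poly_imp_dvd_coeff) (use p U V assms in \<open>auto simp: poly_over_mult\<close>)
  moreover have "coeff (U * V) (i + j) =
      coeff U i * coeff V j + (\<Sum>k\<in>{..i+j}-{i}. coeff U k * coeff V (i + j - k))"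
    by (simp add: coeff_mult sum.remove[of "{..i+j}" i])
  moreover have "p dvd (\<Sum>k\<in>{..i+j}-{i}. coeff U k * coeff V (i + j - k))"
  proof (rule dvd_sum)
    fix k assume "k \<in> {..i+j}-{i}"
    hence "k < i \<or> i + j - k < j" by auto
    thus "p dvd coeff U k * coeff V (i + j - k)" using i' j' by auto
  qed
  ultimately have "p dvd coeff U i * coeff V j" by (simp add: dvd_add_left_iff)
  thus False using prime U V i0 j0 by (auto simp: poly_over_def)
qed

text \<open>Since \<open>A\<close> need not be a field, \<open>U\<close> has to be scaled before
  each elimination of its leading term; the constant built up is a power of the leading coefficient
  of \<open>H\<close>.\<close>

lemma pseudo_division:
  assumes H: "H \<in> poly_over A" "H \<noteq> 0" and "U \<in> poly_over A"
  shows "\<exists>c\<in>A. \<exists>Q\<in>poly_over A. \<exists>R\<in>poly_over A.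
           c \<noteq> 0 \<and> smult c U = Q * H + R \<and> (R = 0 \<or> degree R < degree H)"
  using \<open>U \<in> poly_over A\<close>
proof (induction "degree U" arbitrary: U rule: less_induct)
  case less
  show ?case
  proof (cases "U = 0 \<or> degree U < degree H")
    case True
    thus ?thesis using less.prems A_1 poly_over_0
      by (intro bexI[of _ 1] bexI[of _ 0] bexI[of _ U]) auto
  next
    case False
    hence le: "degree H \<le> degree U" and U0: "U \<noteq> 0" by auto
    define k where "k = degree U - degree H"
    define M where "M = monom (lead_coeff U) k"
    define V where "V = smult (lead_coeff H) U - M * H"
    have lcH: "lead_coeff H \<in> A" "lead_coeff H \<noteq> 0" using H by (auto simp: poly_over_def)
    have M: "M \<in> poly_over A" using less.prems by (simp add: M_def poly_over_monom poly_over_def A_0)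
    have V: "V \<in> poly_over A"
      using M H less.prems lcH by (simp add: V_def poly_over_diff poly_over_mult poly_over_smult)
    have co: "coeff V (degree U) = 0"
      using le by (simp add: V_def M_def k_def coeff_monom_mult mult.commute[of "lead_coeff U"])
    have degV: "degree V \<le> degree U"
    proof -
      have "degree (M * H) \<le> degree M + degree H" by (rule degree_mult_le)
      also have "\<dots> \<le> degree U" using le degree_monom_le[of "lead_coeff U" k] by (simp add: M_def k_def)
      finally show ?thesis unfolding V_def by (intro degree_diff_le) auto
    qed
    \<comment> \<open>The case \<open>V = 0\<close> is separate because the zero polynomial has
      degree 0, which is not below \<open>degree U\<close> for constant \<open>U\<close>.\<close>
    show ?thesis
    proof (cases "V = 0")
      case True
      thus ?thesis using lcH M poly_over_0
        by (intro bexI[of _ "lead_coeff H"] bexI[of _ M] bexI[of _ 0]) (auto simp: V_def)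
    next
      case False
      hence "degree V < degree U" using co degV by (metis le_neq_implies_less leading_coeff_0_iff)
      then obtain c Q R where r: "c \<in> A" "Q \<in> poly_over A" "R \<in> poly_over A" "c \<noteq> 0"
        "smult c V = Q * H + R" "R = 0 \<or> degree R < degree H"
        using less.hyps V by blast
      have "smult (c * lead_coeff H) U = (Q + smult c M) * H + R"
        using r(5) by (simp add: V_def smult_diff_right algebra_simps)
      thus ?thesis using r lcH M
        by (intro bexI[of _ "c * lead_coeff H"] bexI[of _ "Q + smult c M"] bexI[of _ R])
          (simp_all add: A_mult poly_over_add poly_over_smult)
    qed
  qed
qed

lemma pseudo_division_adjoin:
  assumes "H \<in> poly_over A" "H \<noteq> 0" "u \<in> adjoin A x"
  obtains c q R where "c \<in> A" "c \<noteq> 0" "q \<in> adjoin A x" "R \<in> poly_over A"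
    "c * u = q * poly H x + poly R x" "R = 0 \<or> degree R < degree H"
proof -
  obtain U where U: "U \<in> poly_over A" "u = poly U x" using assms by (auto simp: adjoin_def)
  from pseudo_division[OF assms(1,2) U(1)] obtain c Q R where r: "c \<in> A" "Q \<in> poly_over A"
    "R \<in> poly_over A" "c \<noteq> 0" "smult c U = Q * H + R" "R = 0 \<or> degree R < degree H" by blast
  have "c * u = poly Q x * poly H x + poly R x"
    using arg_cong[OF r(5), of "\<lambda>P. poly P x"] U by simp
  thus thesis using that r by (auto simp: adjoin_def)
qed

section \<open>Irreducibles of A[x] are prime, given the same for \<open>A\<close>\<close>

context
  assumes A_prime: "irred_are_prime_in A"
begin

lemma irred_A_prime:
  assumes "irred p" "p \<in> A" "u \<in> adjoin A x" "v \<in> adjoin A x" "p dvd u * v"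
  shows "p dvd u \<or> p dvd v"
  by (rule prime_lift) (use assms A_prime in \<open>auto simp: irred_are_prime_in_def\<close>)

text \<open>An irreducible factor \<open>r\<close> of the constant is prime in A[x]. In r c u = p w
  it divides \<open>w\<close>, and can be cancelled, or it divides \<open>p\<close>; in the latter
  case \<open>p\<close> is associated to \<open>r\<close> and divides a nonzero constant, which is
  excluded.\<close>

lemma cancel_constant:
  assumes p: "irred p" "p \<in> adjoin A x" "\<And>c. c \<in> A \<Longrightarrow> c \<noteq> 0 \<Longrightarrow> \<not> p dvd c"
    and "c \<noteq> 0" "c \<in> A" "u \<in> adjoin A x" "p dvd c * u"
  shows "p dvd u"
  using assms(4-7)
proof (induction c rule: factor_induct)
  case (unit c)
  from unit(1) obtain k where "1 = c * k" by (auto elim: dvdE)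
  hence "u = c * u * k" by (metis mult.assoc mult.commute mult_1)
  thus ?case using unit by (metis dvd_mult2)
next
  case (mult r c)
  have rc: "r \<in> A" "c \<in> A" using mult A_factor[of r c] A_factor[of c r]
    by (auto simp: mult.commute Factorial_Ring.irreducible_def)
  show ?case
  proof (cases "u = 0")
    case False
    obtain w where w: "r * c * u = p * w" using mult.prems by (auto elim: dvdE)
    have nz: "r * c * u \<noteq> 0" using False mult by (auto simp: Factorial_Ring.irreducible_def)
    have "w \<in> adjoin A x"
    proof (rule adjoin_factor[of _ p])
      have "r * c * u \<in> adjoin A x" 
        by (rule adjoin_mult[OF A_adjoin]) (use mult.prems in auto)
      thus "w * p \<in> adjoin A x" unfolding w by (simp only: mult.commute)
      show "w * p \<noteq> 0" using nz unfolding w by auto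
    qed
    hence "r dvd p \<or> r dvd w"
      using irred_A_prime[OF mult(1) rc(1) p(2) \<open>w \<in> adjoin A x\<close>]
        dvd_triv_left[of r "c * u"] w[symmetric] by (simp only: mult.assoc)
    thus ?thesis
    proof
      assume "r dvd p"
      then obtain s where s: "p = r * s" by (auto elim: dvdE)
      hence "s dvd 1" using p(1) mult(1) by (auto simp: Factorial_Ring.irreducible_def)
      hence "p dvd r" using s mult_unit_dvd[of s r] by (simp add: mult.commute)
      thus ?thesis using p(3) rc mult(1) by (auto simp: Factorial_Ring.irreducible_def)
    next
      assume "r dvd w"
      then obtain w' where "w = r * w'" by (auto elim: dvdE)
      hence "c * u = p * w'" using w mult(1)
        by (simp add: Factorial_Ring.irreducible_def mult.assoc mult.left_commute[of p])
      thus ?thesis using mult.IH rc mult.prems by simp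
    qed
  qed simp
qed

text \<open>The irreducible factors of \<open>c\<close> are prime in A[x], so each can be cancelled
  against \<open>q\<close> or \<open>h\<close>. Once \<open>c\<close> is a unit, irreducibility of
  \<open>p\<close> makes what remains of \<open>q\<close> or of \<open>h\<close> a unit; the factors
  taken from \<open>h\<close> are put back into the constant.\<close>

lemma split_constant_multiple:
  assumes p: "irred p" and "c \<noteq> 0" "c \<in> A"
    and "q \<in> adjoin A x" "h \<in> adjoin A x" "q \<noteq> 0" "h \<noteq> 0" "c * p = q * h"
  shows "p dvd h \<or> (\<exists>c\<in>A. c \<noteq> 0 \<and> h dvd c)"
  using assms(2-8)
proof (induction c arbitrary: q h rule: factor_induct)
  case (unit c)
  then obtain c' where c': "1 = c * c'" by (auto elim: dvdE)
  have "p = c' * (c * p)" using c' by (metis mult.assoc mult.commute mult_1)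
  hence "p = (c' * q) * h" using unit.prems by (simp add: mult.assoc)
  hence "c' * q dvd 1 \<or> h dvd 1" using p by (auto simp: Factorial_Ring.irreducible_def)
  thus ?case
  proof
    assume "c' * q dvd 1"
    hence "p dvd h" using \<open>p = (c' * q) * h\<close> by (simp add: mult_unit_dvd)
    thus ?thesis ..
  next
    assume "h dvd 1"
    thus ?thesis using A_1 by (intro disjI2 bexI[of _ 1]) auto
  qed
next
  case (mult r c)
  have r0: "r \<noteq> 0" using mult(1) by auto
  have rc: "r \<in> A" "c \<in> A" using mult A_factor[of r c] A_factor[of c r] r0
    by (auto simp: mult.commute)
  have "r dvd q * h" unfolding mult.prems(6)[symmetric] by simp
  hence "r dvd q \<or> r dvd h" using irred_A_prime[OF mult(1) rc(1)] mult.prems by blast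
  thus ?case
  proof
    assume "r dvd q"
    then obtain q' where q': "q = r * q'" by (auto elim: dvdE)
    have "q' \<in> adjoin A x" using adjoin_factor[of q' r] mult.prems q' by (simp add: mult.commute)
    moreover have "c * p = q' * h" using mult.prems(6) q' r0 by (simp add: mult.assoc)
    ultimately show ?thesis using mult.IH[of q' h] mult.prems q' rc by auto
  next
    assume "r dvd h"
    then obtain h' where h': "h = r * h'" by (auto elim: dvdE)
    have "h' \<in> adjoin A x" using adjoin_factor[of h' r] mult.prems h' by (simp add: mult.commute)
    moreover have "c * p = q * h'"
      using mult.prems(6) h' r0 by (simp add: mult.assoc mult.left_commute[of q])
    ultimately have "p dvd h' \<or> (\<exists>c\<in>A. c \<noteq> 0 \<and> h' dvd c)"
      using mult.IH[of q h'] mult.prems h' rc by auto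
    thus ?thesis
    proof
      assume "p dvd h'" thus ?thesis using h' by simp
    next
      assume "\<exists>c\<in>A. c \<noteq> 0 \<and> h' dvd c"
      then obtain c' where "c' \<in> A" "c' \<noteq> 0" "h' dvd c'" by blast
      hence "r * c' \<in> A" "r * c' \<noteq> 0" "h dvd r * c'" using rc r0 h' by (auto simp: A_mult)
      thus ?thesis by blast
    qed
  qed
qed

text \<open>
  Let \<open>p\<close> divide \<open>u v\<close> and let \<open>h \<noteq> 0\<close> have minimal degree in \<open>x\<close> with \<open>p\<close> dividing \<open>h v\<close>. By
  pseudo-division \<open>h\<close> divides multiples of \<open>p\<close> and of \<open>u\<close> by nonzero constants, i.e. elements of \<open>A\<close>.
  As \<open>p\<close> is irreducible, \<open>h\<close> is therefore, up to constants, a multiple of \<open>p\<close> (then \<open>p\<close> divides \<open>u\<close>)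
  or a unit (then \<open>p\<close> divides \<open>v\<close>).
\<close>

lemma irred_are_prime_in_adjoin: "irred_are_prime_in (adjoin A x)"
  unfolding irred_are_prime_in_def
proof (intro ballI impI)
  fix p u v assume pA: "p \<in> adjoin A x" and p: "irred p"
    and u: "u \<in> adjoin A x" and v: "v \<in> adjoin A x" and dvd: "p dvd u * v"
  have p0: "p \<noteq> 0" using p by auto
  show "p dvd u \<or> p dvd v"
  proof (cases "\<exists>c\<in>A. c \<noteq> 0 \<and> p dvd c")
    \<comment> \<open>Here \<open>p\<close> is itself a constant, as a factor of one, and Gauss's
      lemma applies.\<close>
    case True
    then obtain c w where "c \<in> A" "c \<noteq> 0" "c = p * w" by (auto elim: dvdE)
    hence "p \<in> A" using A_factor by blast
    thus ?thesis using irred_A_prime p u v dvd by blast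
  next
    case False
    hence np: "\<And>c. c \<in> A \<Longrightarrow> c \<noteq> 0 \<Longrightarrow> \<not> p dvd c" by blast
    define J where "J = (\<lambda>H. H \<in> poly_over A \<and> H \<noteq> 0 \<and> p dvd poly H x * v)"
    obtain P where P: "P \<in> poly_over A" "p = poly P x" using pA by (auto simp: adjoin_def)
    have "J P" using P p0 by (auto simp: J_def)
    then obtain H where H: "J H" and min: "\<And>K. J K \<Longrightarrow> degree H \<le> degree K"
      using ex_has_least_nat[of J P degree] by blast
    define h where "h = poly H x"
    have HA: "H \<in> poly_over A" "H \<noteq> 0" and hv: "p dvd h * v" using H by (auto simp: J_def h_def)
    have h0: "h \<noteq> 0" using transcendental HA by (auto simp: h_def)
    have hA: "h \<in> adjoin A x" using HA by (auto simp: adjoin_def h_def)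
    \<comment> \<open>The remainder satisfies the divisibility required by \<open>J\<close>, so
      minimality of \<open>degree H\<close> forces it to be 0. This is used for \<open>p\<close> and
      for \<open>u\<close>.\<close>
    have exact: "\<exists>c\<in>A. \<exists>q\<in>adjoin A x. c \<noteq> 0 \<and> c * w = q * h"
      if w: "w \<in> adjoin A x" "p dvd w * v" for w
    proof -
      obtain c q R where r: "c \<in> A" "c \<noteq> 0" "q \<in> adjoin A x" "R \<in> poly_over A"
        "c * w = q * poly H x + poly R x" "R = 0 \<or> degree R < degree H"
        using pseudo_division_adjoin[OF HA w(1)] .
      have "poly R x * v = c * (w * v) - q * (h * v)" 
      proof -
        have "poly R x = c * w - q * h" using r(5) by (simp add: h_def)
        thus ?thesis by (simp add: left_diff_distrib mult.assoc)
      qed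
      hence "p dvd poly R x * v" using w hv by simp
      hence "R = 0" using min[of R] r by (force simp: J_def)
      thus ?thesis using r by (auto simp: h_def)
    qed
    obtain c q where cq: "c \<in> A" "q \<in> adjoin A x" "c \<noteq> 0" "c * p = q * h"
      using exact[of p] pA by auto
    have "p dvd h \<or> (\<exists>c\<in>A. c \<noteq> 0 \<and> h dvd c)"
      by (rule split_constant_multiple[OF p cq(3,1,2) hA]) (use cq p0 h0 in auto)
    thus ?thesis
    proof
      assume ph: "p dvd h"
      obtain c q where cq: "c \<in> A" "c \<noteq> 0" "c * u = q * h" using exact[of u] u dvd by auto
      hence "p dvd c * u" using ph by simp
      thus ?thesis using cancel_constant[OF p pA np cq(2,1) u] by blast
    next
      assume "\<exists>c\<in>A. c \<noteq> 0 \<and> h dvd c"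
      then obtain c where c: "c \<in> A" "c \<noteq> 0" "h dvd c" by blast
      hence "p dvd c * v" using dvd_trans[OF hv mult_dvd_mono[OF c(3) dvd_refl]] by simp
      thus ?thesis using cancel_constant[OF p pA np c(2,1) v] by blast
    qed
  qed
qed

end

end


section \<open>Unique factorization in the polynomial ring\<close>

lemma keys_uminus: "Poly_Mapping.keys (- p) = Poly_Mapping.keys (p :: 'a \<Rightarrow>\<^sub>0 'b::ab_group_add)"
  by (auto simp: in_keys_iff)

lemma keys_minus_subset:
  "Poly_Mapping.keys (p - q) \<subseteq> Poly_Mapping.keys p \<union> Poly_Mapping.keys (q :: 'a \<Rightarrow>\<^sub>0 'b::ab_group_add)"
  by (auto simp: in_keys_iff lookup_minus)

lemma keys_sumE:
  assumes "t \<in> Poly_Mapping.keys (sum h I)"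
  obtains i where "i \<in> I" "t \<in> Poly_Mapping.keys (h i)"
  using assms keys_sum[of h I] by blast

lemma keys_nonemptyE:
  assumes "p \<noteq> 0"
  obtains t where "t \<in> Poly_Mapping.keys p"
  using assms keys_eq_empty[of p] by blast

lemma sum_single_keys:
  "p = (\<Sum>t\<in>Poly_Mapping.keys p. Poly_Mapping.single t (Poly_Mapping.lookup p t))"
  by (rule poly_mapping_eqI) (auto simp: lookup_sum lookup_single when_def in_keys_iff)

lemma lookup_single_mult:
  fixes p :: "'a::cancel_comm_monoid_add \<Rightarrow>\<^sub>0 'b::comm_semiring_0"
  shows "Poly_Mapping.lookup (Poly_Mapping.single s c * p) (s + t) = c * Poly_Mapping.lookup p t"
proof -
  have "Poly_Mapping.single s c * p =
      (\<Sum>k\<in>Poly_Mapping.keys p. Poly_Mapping.single (s + k) (c * Poly_Mapping.lookup p k))"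
    by (subst sum_single_keys[of p]) (simp add: sum_distrib_left mult_single)
  also have "Poly_Mapping.lookup \<dots> (s + t) = (\<Sum>k\<in>Poly_Mapping.keys p. if k = t then c * Poly_Mapping.lookup p k else 0)"
    by (auto simp: lookup_sum lookup_single when_def intro!: sum.cong)
  also have "\<dots> = c * Poly_Mapping.lookup p t"
    by (auto simp: in_keys_iff)
  finally show ?thesis .
qed

text \<open>The parts of \<open>p\<close> and \<open>q\<close> of maximal weight have a nonzero product, and no other
  products of monomials reach its weight.\<close>

lemma max_weight_key_mult:
  fixes p q :: "'k::field mpoly" and w :: "(nat \<Rightarrow>\<^sub>0 nat) \<Rightarrow> nat"
  assumes w: "\<And>s t. w (s + t) = w s + w t" and "p \<noteq> 0" "q \<noteq> 0"
  obtains s t where "s \<in> Poly_Mapping.keys p" "t \<in> Poly_Mapping.keys q"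
    "s + t \<in> Poly_Mapping.keys (p * q)"
    "\<forall>s'\<in>Poly_Mapping.keys p. w s' \<le> w s" "\<forall>t'\<in>Poly_Mapping.keys q. w t' \<le> w t"
proof -
  define top where "top = (\<lambda>p :: 'k mpoly. Poly_Mapping.mapp
    (\<lambda>k v. if w k = Max (w ` Poly_Mapping.keys p) then v else 0) p)"
  have top: "Poly_Mapping.lookup (top p) k =
      (if w k = Max (w ` Poly_Mapping.keys p) then Poly_Mapping.lookup p k else 0)" for p k
    by (auto simp: top_def lookup_mapp when_def in_keys_iff)
  have le: "w k \<le> Max (w ` Poly_Mapping.keys p)" if "k \<in> Poly_Mapping.keys p" for p :: "'k mpoly" and k
    using that by simp
  have keys_top: "k \<in> Poly_Mapping.keys p \<and> w k = Max (w ` Poly_Mapping.keys p)"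
    if "k \<in> Poly_Mapping.keys (top p)" for p k
    using that by (auto simp: in_keys_iff top split: if_splits)
  have keys_rest: "w k < Max (w ` Poly_Mapping.keys p)"
    if "k \<in> Poly_Mapping.keys (p - top p)" for p k
  proof -
    have "k \<in> Poly_Mapping.keys p \<and> w k \<noteq> Max (w ` Poly_Mapping.keys p)"
      using that by (auto simp: in_keys_iff top lookup_minus split: if_splits)
    thus ?thesis using le le_neq_implies_less by blast
  qed
  have top_nz: "top p \<noteq> 0" if "p \<noteq> 0" for p
  proof -
    have "Max (w ` Poly_Mapping.keys p) \<in> w ` Poly_Mapping.keys p"
      using that by (intro Max_in) auto
    then obtain k where "k \<in> Poly_Mapping.keys p" "w k = Max (w ` Poly_Mapping.keys p)" by auto
    hence "k \<in> Poly_Mapping.keys (top p)" by (simp add: in_keys_iff top)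
    thus ?thesis by auto
  qed
  \<comment> \<open>Several monomials may share the maximal weight, so the top parts need not be
    single terms; their product is nonzero because the ring is a domain.\<close>
  have "top p * top q \<noteq> 0" using top_nz assms by simp
  then obtain u where u: "u \<in> Poly_Mapping.keys (top p * top q)" by (rule keys_nonemptyE)
  then obtain s t where st: "u = s + t" "s \<in> Poly_Mapping.keys (top p)" "t \<in> Poly_Mapping.keys (top q)"
    using keys_mult[of "top p" "top q"] by blast
  have 1: "u \<notin> Poly_Mapping.keys (top p * (q - top q))"
  proof
    assume "u \<in> Poly_Mapping.keys (top p * (q - top q))"
    then obtain s' t' where "u = s' + t'" "s' \<in> Poly_Mapping.keys (top p)" "t' \<in> Poly_Mapping.keys (q - top q)"
      using keys_mult[of "top p" "q - top q"] by blast
    hence "w s + w t = w s' + w t'" "w s' = w s" "w t' < w t"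
      using st keys_top[of s p] keys_top[of s' p] keys_top[of t q] keys_rest[of t' q] w[of s t] w[of s' t'] by auto
    thus False by simp
  qed
  have 2: "u \<notin> Poly_Mapping.keys ((p - top p) * q)"
  proof
    assume "u \<in> Poly_Mapping.keys ((p - top p) * q)"
    then obtain s' t' where "u = s' + t'" "s' \<in> Poly_Mapping.keys (p - top p)" "t' \<in> Poly_Mapping.keys q"
      using keys_mult[of "p - top p" q] by blast
    hence "w s + w t = w s' + w t'" "w s' < w s" "w t' \<le> w t"
      using st keys_top[of s p] keys_top[of t q] keys_rest[of s' p] le[of t' q] w[of s t] w[of s' t'] by auto
    thus False by simp
  qed
  \<comment> \<open>The last two products only involve monomials of smaller weight than
    \<open>u\<close>, so they contribute nothing to its coefficient.\<close>
  have "p * q = top p * top q + top p * (q - top q) + (p - top p) * q" by (simp add: algebra_simps)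
  hence "Poly_Mapping.lookup (p * q) u = Poly_Mapping.lookup (top p * top q) u"
    using 1 2 by (simp add: lookup_add in_keys_iff)
  hence "s + t \<in> Poly_Mapping.keys (p * q)" using u st by (simp add: in_keys_iff)
  thus thesis using that[of s t] st keys_top le by metis
qed


section \<open>The subring of polynomials in \<open>x_1, ..., x_m\<close>\<close>

lemma carrier_poly_ring:
  "p \<in> carrier (poly_ring m) \<longleftrightarrow> (\<forall>t\<in>Poly_Mapping.keys p. Poly_Mapping.keys t \<subseteq> {1..m})"
  by (simp add: poly_ring_def)

lemma poly_ring_simps [simp]:
  "x \<otimes>\<^bsub>poly_ring m\<^esub> y = x * y" "\<one>\<^bsub>poly_ring m\<^esub> = 1" "\<zero>\<^bsub>poly_ring m\<^esub> = 0" "x \<oplus>\<^bsub>poly_ring m\<^esub> y = x + y"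
  by (simp_all add: poly_ring_def)

lemma carrier_0 [simp]: "0 \<in> carrier (poly_ring m)"
  and carrier_1 [simp]: "1 \<in> carrier (poly_ring m)"
  by (auto simp: carrier_poly_ring)

lemma carrier_add [intro]: "p \<in> carrier (poly_ring m) \<Longrightarrow> q \<in> carrier (poly_ring m) \<Longrightarrow> p + q \<in> carrier (poly_ring m)"
  unfolding carrier_poly_ring using keys_add[of p q] by blast

lemma carrier_uminus [intro]: "p \<in> carrier (poly_ring m) \<Longrightarrow> - p \<in> carrier (poly_ring m)"
  by (simp add: carrier_poly_ring keys_uminus)

lemma carrier_diff [intro]: "p \<in> carrier (poly_ring m) \<Longrightarrow> q \<in> carrier (poly_ring m) \<Longrightarrow> p - q \<in> carrier (poly_ring m)"
  unfolding carrier_poly_ring using keys_minus_subset[of p q] by blast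

lemma carrier_mult [intro]:
  assumes "p \<in> carrier (poly_ring m)" "q \<in> carrier (poly_ring m)"
  shows "p * q \<in> carrier (poly_ring m)"
  unfolding carrier_poly_ring
proof
  fix t assume "t \<in> Poly_Mapping.keys (p * q)"
  then obtain a b where "t = a + b" "a \<in> Poly_Mapping.keys p" "b \<in> Poly_Mapping.keys q"
    using keys_mult[of p q] by blast
  thus "Poly_Mapping.keys t \<subseteq> {1..m}"
      using assms keys_add[of a b] unfolding carrier_poly_ring by blast
qed

lemma carrier_sum [intro]: "(\<And>i. i \<in> I \<Longrightarrow> h i \<in> carrier (poly_ring m)) \<Longrightarrow> sum h I \<in> carrier (poly_ring m)"
  by (induction I rule: infinite_finite_induct) auto

lemma carrier_power [intro]: "p \<in> carrier (poly_ring m) \<Longrightarrow> p ^ k \<in> carrier (poly_ring m)"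
  by (induction k) auto

lemma carrier_var [intro]: "i \<in> {1..m} \<Longrightarrow> var i \<in> carrier (poly_ring m)"
  by (auto simp: carrier_poly_ring var_def)

lemma carrier_mono: "m \<le> m' \<Longrightarrow> p \<in> carrier (poly_ring m) \<Longrightarrow> p \<in> carrier (poly_ring m')"
  by (fastforce simp: carrier_poly_ring)

lemma var_power: "var i ^ k = (Poly_Mapping.single (Poly_Mapping.single i k) 1 :: 'k::field mpoly)"
proof (induction k)
  case (Suc k)
  thus ?case by (simp add: var_def mult_single flip: single_add)
qed simp

lemma var_nz: "var i \<noteq> (0 :: 'k::field mpoly)"
  unfolding var_def by (metis keys_zero keys_single zero_neq_one insert_not_empty)

lemma keys_mult_varE:
  assumes "t \<in> Poly_Mapping.keys (p * var i)"
  obtains s where "s \<in> Poly_Mapping.keys p" "t = s + Poly_Mapping.single i 1"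
  using assms keys_mult[of p "var i"] by (auto simp: var_def)

text \<open>Take as weight the exponent of a variable \<open>x_j\<close> outside the ring: if
  \<open>x_j\<close> occurred in \<open>a\<close>, it would occur in a monomial of the product that
  survives.\<close>

lemma carrier_factor:
  fixes a b :: "'k::field mpoly"
  assumes "a * b \<in> carrier (poly_ring m)" "a * b \<noteq> 0"
  shows "a \<in> carrier (poly_ring m)"
  unfolding carrier_poly_ring
proof (intro ballI subsetI)
  fix t j assume t: "t \<in> Poly_Mapping.keys a" and j: "j \<in> Poly_Mapping.keys t"
  show "j \<in> {1..m}"
  proof (rule ccontr)
    assume nj: "j \<notin> {1..m}"
    have nz: "a \<noteq> 0" "b \<noteq> 0" using assms by auto
    obtain s s' where s: "s + s' \<in> Poly_Mapping.keys (a * b)"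
      "\<forall>t\<in>Poly_Mapping.keys a. Poly_Mapping.lookup t j \<le> Poly_Mapping.lookup s j"
      by (rule max_weight_key_mult[of "\<lambda>t. Poly_Mapping.lookup t j", OF lookup_add nz])
    hence "Poly_Mapping.lookup (s + s') j = 0"
      using assms nj unfolding carrier_poly_ring by (meson in_keys_iff subsetD)
    thus False using bspec[OF s(2) t] j by (simp add: lookup_add in_keys_iff)
  qed
qed

section \<open>Total degree as an additive measure\<close>

lemma mon_degree_eq_sum:
  assumes "finite K" "Poly_Mapping.keys t \<subseteq> K"
  shows "mon_degree t = (\<Sum>i\<in>K. Poly_Mapping.lookup t i)"
  unfolding mon_degree_def using assms by (intro sum.mono_neutral_left) (auto simp: in_keys_iff)

lemma mon_degree_add: "mon_degree (s + t) = mon_degree s + mon_degree t"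
proof -
  let ?K = "Poly_Mapping.keys s \<union> Poly_Mapping.keys t"
  have "mon_degree u = (\<Sum>i\<in>?K. Poly_Mapping.lookup u i)" if "u \<in> {s, t, s + t}" for u
    by (rule mon_degree_eq_sum) (use that keys_add[of s t] in auto)
  thus ?thesis by (simp add: lookup_add sum.distrib)
qed

lemma mon_degree_single [simp]: "mon_degree (Poly_Mapping.single i k) = k"
  by (simp add: mon_degree_def)

lemma mon_degree_eq_0: "mon_degree t = 0 \<Longrightarrow> t = 0"
  by (auto simp: mon_degree_def in_keys_iff intro!: poly_mapping_eqI)

text \<open>For \<open>p = 0\<close> this is an unspecified \<open>Max {}\<close>; the laws of an
  additive measure only concern nonzero elements.\<close>

definition total_degree :: "'k::field mpoly \<Rightarrow> nat"
  where "total_degree p = Max (mon_degree ` Poly_Mapping.keys p)"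

interpretation total_degree: additive_measure "total_degree :: 'k::field mpoly \<Rightarrow> nat"
proof
  fix a b :: "'k mpoly" assume nz: "a \<noteq> 0" "b \<noteq> 0"
  obtain s t where st: "s \<in> Poly_Mapping.keys a" "t \<in> Poly_Mapping.keys b"
    "s + t \<in> Poly_Mapping.keys (a * b)"
    "\<forall>s'\<in>Poly_Mapping.keys a. mon_degree s' \<le> mon_degree s"
    "\<forall>t'\<in>Poly_Mapping.keys b. mon_degree t' \<le> mon_degree t"
    by (rule max_weight_key_mult[of mon_degree, OF mon_degree_add nz])
  have "total_degree a = mon_degree s" "total_degree b = mon_degree t"
    unfolding total_degree_def using st by (auto intro!: Max_eqI)
  moreover have "total_degree (a * b) = mon_degree (s + t)"
    unfolding total_degree_def
  proof (rule Max_eqI)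
    fix y assume "y \<in> mon_degree ` Poly_Mapping.keys (a * b)"
    then obtain s' t' where "y = mon_degree (s' + t')" "s' \<in> Poly_Mapping.keys a" "t' \<in> Poly_Mapping.keys b"
      using keys_mult[of a b] by blast
    thus "y \<le> mon_degree (s + t)" using st by (simp add: mon_degree_add add_mono)
  qed (use st in auto)
  ultimately show "total_degree (a * b) = total_degree a + total_degree b"
    by (simp add: mon_degree_add)
next
  fix a :: "'k mpoly" assume a: "a \<noteq> 0" "total_degree a = 0"
  have "t = 0" if "t \<in> Poly_Mapping.keys a" for t
    using a that Max_ge[of "mon_degree ` Poly_Mapping.keys a" "mon_degree t"]
    by (intro mon_degree_eq_0) (simp add: total_degree_def)
  hence keys: "Poly_Mapping.keys a = {0}" using a by (metis keys_eq_empty is_singletonI' is_singleton_the_elem singletonD insertI1)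
  define c where "c = Poly_Mapping.lookup a 0"
  have c: "a = Poly_Mapping.single 0 c" "c \<noteq> 0"
    using sum_single_keys[of a] keys by (auto simp: c_def in_keys_iff)
  have "1 = a * Poly_Mapping.single 0 (inverse c)"
    using c by (simp add: mult_single)
  thus "a dvd 1" by (rule dvdI)
qed

lemma adjoin_poly_ring:
  "adjoin (carrier (poly_ring m)) (var (Suc m)) = (carrier (poly_ring (Suc m)) :: 'k::field mpoly set)"
proof (intro subset_antisym subsetI)
  fix p :: "'k mpoly" assume "p \<in> adjoin (carrier (poly_ring m)) (var (Suc m))"
  then obtain P where P: "\<And>i. coeff P i \<in> carrier (poly_ring m)" "p = poly P (var (Suc m))"
    by (auto simp: adjoin_def poly_over_def)
  show "p \<in> carrier (poly_ring (Suc m))"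
    unfolding P(2) poly_altdef using P(1) carrier_mono[of m "Suc m"] by (auto intro!: carrier_sum carrier_mult carrier_power carrier_var)
next
  fix p :: "'k mpoly" assume p: "p \<in> carrier (poly_ring (Suc m))"
  \<comment> \<open>\<open>r t\<close> is the monomial \<open>t\<close> without its power of the
    last variable; \<open>P\<close> sorts the terms of \<open>p\<close> by that power.\<close>
  define r where "r = (\<lambda>t. Poly_Mapping.update (Suc m) 0 t :: nat \<Rightarrow>\<^sub>0 nat)"
  define P where "P = (\<Sum>t\<in>Poly_Mapping.keys p.
    monom (Poly_Mapping.single (r t) (Poly_Mapping.lookup p t)) (Poly_Mapping.lookup t (Suc m)))"
  have "r t + Poly_Mapping.single (Suc m) (Poly_Mapping.lookup t (Suc m)) = t" for t
    by (rule poly_mapping_eqI) (simp add: r_def lookup_add lookup_update lookup_single when_def)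
  hence "poly P (var (Suc m)) = (\<Sum>t\<in>Poly_Mapping.keys p. Poly_Mapping.single t (Poly_Mapping.lookup p t))"
    by (simp add: P_def poly_sum poly_monom var_power mult_single)
  hence "poly P (var (Suc m)) = p" by (simp flip: sum_single_keys)
  moreover have "P \<in> poly_over (carrier (poly_ring m))"
    unfolding poly_over_def P_def
  proof (intro CollectI allI)
    fix i
    have "Poly_Mapping.single (r t) (Poly_Mapping.lookup p t) \<in> carrier (poly_ring m)"
      if "t \<in> Poly_Mapping.keys p" for t
      using p that by (fastforce simp: carrier_poly_ring r_def keys_update)
    thus "coeff (\<Sum>t\<in>Poly_Mapping.keys p. monom (Poly_Mapping.single (r t) (Poly_Mapping.lookup p t)) (Poly_Mapping.lookup t (Suc m))) i \<in> carrier (poly_ring m)"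
      by (auto simp: coeff_sum intro!: carrier_sum)
  qed
  ultimately show "p \<in> adjoin (carrier (poly_ring m)) (var (Suc m))" by (auto simp: adjoin_def)
qed

text \<open>The last variable has exponent exactly \<open>i\<close> in every monomial of the
  \<open>i\<close>-th summand, so distinct summands cannot cancel; the leading one is
  nonzero.\<close>

lemma var_transcendental:
  fixes P :: "'k::field mpoly poly"
  assumes P: "P \<in> poly_over (carrier (poly_ring m))" and "poly P (var (Suc m)) = 0"
  shows "P = 0"
proof (rule ccontr)
  assume "P \<noteq> 0"
  have w: "Poly_Mapping.lookup t (Suc m) = i"
    if t: "t \<in> Poly_Mapping.keys (coeff P i * var (Suc m) ^ i)" for t i
  proof -
    obtain s where s: "s \<in> Poly_Mapping.keys (coeff P i)" "t = s + Poly_Mapping.single (Suc m) i"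
      using t keys_mult[of "coeff P i" "var (Suc m) ^ i"] by (auto simp: var_power)
    moreover have "Poly_Mapping.lookup s (Suc m) = 0"
      using P s(1) by (fastforce simp: poly_over_def carrier_poly_ring simp flip: not_in_keys_iff_lookup_eq_zero)
    ultimately show ?thesis by (simp add: lookup_add)
  qed
  let ?D = "degree P"
  have "lead_coeff P * var (Suc m) ^ ?D \<noteq> 0" using \<open>P \<noteq> 0\<close> by (simp add: var_nz)
  then obtain u where u: "u \<in> Poly_Mapping.keys (lead_coeff P * var (Suc m) ^ ?D)"
    by (rule keys_nonemptyE)
  have "0 = Poly_Mapping.lookup (poly P (var (Suc m))) u" using assms by simp
  also have "\<dots> = (\<Sum>i\<le>?D. Poly_Mapping.lookup (coeff P i * var (Suc m) ^ i) u)"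
    by (simp add: poly_altdef lookup_sum)
  also have "\<dots> = (\<Sum>i\<le>?D. if i = ?D then Poly_Mapping.lookup (lead_coeff P * var (Suc m) ^ ?D) u else 0)"
    using w w[OF u] by (intro sum.cong) (auto simp flip: not_in_keys_iff_lookup_eq_zero)
  also have "\<dots> = Poly_Mapping.lookup (lead_coeff P * var (Suc m) ^ ?D) u" by simp
  finally show False using u by (simp add: in_keys_iff)
qed

lemma factor_closed_extension_poly_ring:
  "factor_closed_extension total_degree (carrier (poly_ring m)) (var (Suc m) :: 'k::field mpoly)"
  by unfold_locales
    (auto simp: adjoin_poly_ring intro: carrier_factor var_transcendental)

lemma irred_are_prime_in_poly_ring: "irred_are_prime_in (carrier (poly_ring m) :: 'k::field mpoly set)"
proof (induction m)
  case 0
  \<comment> \<open>With no variables there are only constants, each 0 or a unit, and the claim is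
    vacuous.\<close>
  have "\<not> irred p" if p: "p \<in> carrier (poly_ring 0)" for p :: "'k mpoly"
  proof
    assume irr: "irred p"
    hence nz: "p \<noteq> 0" by auto
    have "mon_degree t = 0" if "t \<in> Poly_Mapping.keys p" for t
      using p that by (auto simp: carrier_poly_ring mon_degree_def)
    hence "mon_degree ` Poly_Mapping.keys p = {0}" using keys_nonemptyE[OF nz] by force
    hence "total_degree p = 0" by (simp add: total_degree_def)
    thus False using total_degree.mu_0_unit[OF nz] irr by (auto simp: Factorial_Ring.irreducible_def)
  qed
  thus ?case by (auto simp: irred_are_prime_in_def)
next
  case (Suc m)
  interpret factor_closed_extension total_degree "carrier (poly_ring m)" "var (Suc m) :: 'k mpoly"
    by (rule factor_closed_extension_poly_ring)
  show ?case using irred_are_prime_in_adjoin[OF Suc.IH] by (simp add: adjoin_poly_ring)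
qed

text \<open>Translates the coprimality hypothesis to \<open>dvd\<close> in the ambient type. A
  nonzero \<open>b\<close> has its quotient in the ring by \<open>carrier_factor\<close>; for
  \<open>b = 0\<close> the quotient 0 serves.\<close>

lemma divides_poly_ring:
  fixes a b :: "'k::field mpoly"
  assumes "b \<in> carrier (poly_ring m)"
  shows "a divides\<^bsub>poly_ring m\<^esub> b \<longleftrightarrow> a dvd b"
proof
  assume "a dvd b"
  then obtain c where c: "b = c * a" by (auto simp: dvd_def mult.commute)
  show "a divides\<^bsub>poly_ring m\<^esub> b"
  proof (cases "b = 0")
    case True
    thus ?thesis by (auto simp: factor_def intro!: bexI[of _ 0])
  next
    case False
    hence "c \<in> carrier (poly_ring m)" using carrier_factor[of c a m] assms c by simp
    thus ?thesis using c by (auto simp: factor_def mult.commute)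
  qed
qed (auto simp: factor_def)

text \<open>Strip irreducible factors from \<open>f\<close> one at a time: each is prime and does
  not divide \<open>g\<close>, so it divides \<open>v\<close> and cancels.\<close>

lemma relatively_prime_dvd_mult:
  fixes f g v :: "'k::field mpoly"
  assumes "relatively_prime (poly_ring m) f g" "f \<noteq> 0"
    and "f \<in> carrier (poly_ring m)" "g \<in> carrier (poly_ring m)" "v \<in> carrier (poly_ring m)"
    and "f dvd v * g"
  shows "f dvd v"
proof -
  \<comment> \<open>In this form coprimality passes to the divisors of \<open>f\<close>, as the
    induction demands.\<close>
  have unit: "c dvd 1" if "c dvd f" "c dvd g" for c
  proof -
    obtain b where "f = c * b" using \<open>c dvd f\<close> unfolding dvd_def by blast
    hence "c \<in> carrier (poly_ring m)" using assms carrier_factor[of c b m] by simp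
    hence "c \<in> Units (poly_ring m)"
      using that assms by (simp add: relatively_prime_def divides_poly_ring)
    then obtain b where "c * b = 1" by (auto simp: Units_def)
    thus ?thesis by (metis dvdI)
  qed
  show ?thesis
    using assms(2,3,5,6) unit
  proof (induction f arbitrary: v rule: total_degree.factor_induct)
    case (unit c)
    thus ?case by (meson dvd_trans one_dvd)
  next
    case (mult p c)
    have p0: "p \<noteq> 0" using mult(1) by auto
    have pc: "p \<in> carrier (poly_ring m)" "c \<in> carrier (poly_ring m)"
      using mult p0 carrier_factor[of p c m] carrier_factor[of c p m] by (auto simp: mult.commute)
    have "p dvd v * g" using mult.prems(3) by (rule dvd_mult_left)
    moreover have "\<not> p dvd g"
      using mult.prems(4)[of p] mult(1) by (auto simp: Factorial_Ring.irreducible_def)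
    ultimately have "p dvd v"
      using irred_are_prime_in_poly_ring[of m] mult assms(4) pc by (auto simp: irred_are_prime_in_def)
    then obtain v' where v': "v = p * v'" by (auto elim: dvdE)
    show ?case
    proof (cases "v = 0")
      case False
      hence "v' \<in> carrier (poly_ring m)" using carrier_factor[of v' p m] mult.prems v' by (simp add: mult.commute)
      moreover have "c dvd v' * g" using mult.prems(3) p0 by (simp add: v' mult.assoc)
      moreover have "b dvd 1" if "b dvd c" "b dvd g" for b using mult.prems(4) that by simp
      ultimately have "c dvd v'" using mult.IH pc by blast
      thus ?thesis using v' by simp
    qed simp
  qed
qed


section \<open>Ideals generated by variables\<close>

lemma is_ring_poly_ring: "ring (poly_ring m :: 'k::field mpoly ring)"
proof (rule ringI)
  show "abelian_group (poly_ring m :: 'k mpoly ring)"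
    by (rule abelian_groupI) (auto intro: carrier_uminus bexI[of _ "- _"])
  show "monoid (poly_ring m :: 'k mpoly ring)"
    by (rule monoidI) (auto simp: mult.assoc)
qed (auto simp: algebra_simps)

text \<open>The coefficient families are extensional functions on \<open>I\<close>, the shape of
  elements of \<open>free_mod\<close>, so the image of the first differential can be compared with
  the ideal directly.\<close>

lemma genideal_finite_family:
  fixes h :: "'i \<Rightarrow> 'k::field mpoly"
  assumes "finite I" and h: "\<And>i. i \<in> I \<Longrightarrow> h i \<in> carrier (poly_ring m)"
  shows "Idl\<^bsub>poly_ring m\<^esub> (h ` I) = (\<lambda>c. \<Sum>i\<in>I. h i * c i) ` (I \<rightarrow>\<^sub>E carrier (poly_ring m))"
    (is "_ = ?J")
proof -
  let ?R = "poly_ring m :: 'k mpoly ring"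
  interpret ring ?R by (rule is_ring_poly_ring)
  have rep: "(\<Sum>i\<in>I. h i * c i) \<in> ?J" if "\<And>i. i \<in> I \<Longrightarrow> c i \<in> carrier ?R" for c
    by (rule image_eqI[of _ _ "restrict c I"]) (use that in auto)
  have "ideal ?J ?R"
  proof (rule idealI)
    show "ring ?R" by (rule is_ring_poly_ring)
    show "subgroup ?J (add_monoid ?R)"
    proof (rule add.subgroupI)
      show "?J \<subseteq> carrier ?R" using h by (auto intro!: carrier_sum carrier_mult)
      show "?J \<noteq> {}" using rep[of "\<lambda>_. 0"] by auto
    next
      fix a assume "a \<in> ?J"
      then obtain c where c: "c \<in> I \<rightarrow>\<^sub>E carrier ?R" "a = (\<Sum>i\<in>I. h i * c i)" by auto
      have aR: "a \<in> carrier ?R" unfolding c using c h by (auto intro!: carrier_sum carrier_mult)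
      have "- a \<in> ?J" using rep[of "\<lambda>i. - c i"] c by (auto simp: sum_negf)
      moreover have "\<ominus>\<^bsub>?R\<^esub> a = - a" using aR by (intro minus_equality) auto
      ultimately show "\<ominus>\<^bsub>?R\<^esub> a \<in> ?J" by simp
    next
      fix a b assume "a \<in> ?J" "b \<in> ?J"
      then obtain c c' where c: "c \<in> I \<rightarrow>\<^sub>E carrier ?R" "a = (\<Sum>i\<in>I. h i * c i)"
         "c' \<in> I \<rightarrow>\<^sub>E carrier ?R" "b = (\<Sum>i\<in>I. h i * c' i)" by auto
      have "a + b = (\<Sum>i\<in>I. h i * (c i + c' i))" using c by (simp add: distrib_left sum.distrib)
      thus "a \<oplus>\<^bsub>?R\<^esub> b \<in> ?J" using rep[of "\<lambda>i. c i + c' i"] c by auto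
    qed
  next
    fix a y assume a: "a \<in> ?J" and y: "y \<in> carrier ?R"
    then obtain c where c: "c \<in> I \<rightarrow>\<^sub>E carrier ?R" "a = (\<Sum>i\<in>I. h i * c i)" by auto
    have "y * a = (\<Sum>i\<in>I. h i * (y * c i))" by (simp add: c sum_distrib_left mult.left_commute)
    hence "y * a \<in> ?J" using rep[of "\<lambda>i. y * c i"] c y by auto
    thus "y \<otimes>\<^bsub>?R\<^esub> a \<in> ?J" "a \<otimes>\<^bsub>?R\<^esub> y \<in> ?J" by (simp_all add: mult.commute)
  qed
  moreover have "h ` I \<subseteq> ?J"
  proof
    fix y assume "y \<in> h ` I"
    then obtain i where i: "i \<in> I" "y = h i" by auto
    have "(\<Sum>k\<in>I. h k * (if k = i then 1 else 0)) = (\<Sum>k\<in>I. if k = i then h k else 0)"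
      by (intro sum.cong) auto
    also have "\<dots> = h i" using i \<open>finite I\<close> by simp
    finally show "y \<in> ?J" using rep[of "\<lambda>k. if k = i then 1 else 0"] i by auto
  qed
  moreover have "?J \<subseteq> K" if K: "ideal K ?R" "h ` I \<subseteq> K" for K
  proof
    interpret K: ideal K ?R by (rule K)
    fix a assume "a \<in> ?J"
    then obtain c where c: "c \<in> I \<rightarrow>\<^sub>E carrier ?R" "a = (\<Sum>i\<in>I. h i * c i)" by auto
    have "(\<Sum>i\<in>I'. h i * c i) \<in> K" if "I' \<subseteq> I" for I'
      using that
    proof (induction I' rule: infinite_finite_induct)
      case (insert j I')
      have "h j * c j \<in> K" using K.I_r_closed[of "h j" "c j"] K(2) insert.prems c(1) by auto
      thus ?case using insert K.a_closed[of "h j * c j"] by simp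
    qed (use K.zero_closed in auto)
    thus "a \<in> K" using c by auto
  qed
  ultimately show ?thesis unfolding genideal_def by blast
qed

text \<open>Choose for each monomial of \<open>p\<close> one of the first \<open>n\<close> variables
  dividing it, and let \<open>q j\<close> collect the quotients of the monomials assigned to
  \<open>x_j\<close>. Dividing monomials by a single variable keeps forms homogeneous.\<close>

lemma decompose_wrt_vars:
  fixes p :: "'k::field mpoly"
  assumes p: "p \<in> carrier (poly_ring m)"
    and ex: "\<forall>t\<in>Poly_Mapping.keys p. \<exists>j\<in>{1..n}. j \<in> Poly_Mapping.keys t"
  obtains q where "\<forall>j. q j \<in> carrier (poly_ring m)" "p = (\<Sum>j=1..n. q j * var j)"
    "\<forall>e j. form (Suc e) p \<longrightarrow> form e (q j)"
proof -
  obtain \<sigma> where \<sigma>: "\<And>t. t \<in> Poly_Mapping.keys p \<Longrightarrow> \<sigma> t \<in> {1..n} \<and> \<sigma> t \<in> Poly_Mapping.keys t"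
    using bchoice[OF ex[rule_format, THEN bexE]] ex by metis
  define r where "r = (\<lambda>t. t - Poly_Mapping.single (\<sigma> t) 1 :: nat \<Rightarrow>\<^sub>0 nat)"
  have r: "r t + Poly_Mapping.single (\<sigma> t) 1 = t" if "t \<in> Poly_Mapping.keys p" for t
    using \<sigma>[OF that] by (intro poly_mapping_eqI) (auto simp: r_def lookup_add lookup_minus lookup_single when_def in_keys_iff)
  have keys_r: "Poly_Mapping.keys (r t) \<subseteq> Poly_Mapping.keys t" for t
    by (auto simp: r_def in_keys_iff lookup_minus)
  define q where "q = (\<lambda>j. \<Sum>t\<in>{t \<in> Poly_Mapping.keys p. \<sigma> t = j}. Poly_Mapping.single (r t) (Poly_Mapping.lookup p t))"
  have keys_q: "\<exists>t\<in>Poly_Mapping.keys p. s = r t" if "s \<in> Poly_Mapping.keys (q j)" for s j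
    using that unfolding q_def by (auto elim!: keys_sumE split: if_splits)
  have "q j \<in> carrier (poly_ring m)" for j
    unfolding carrier_poly_ring using keys_q keys_r p unfolding carrier_poly_ring by blast
  moreover have "p = (\<Sum>j=1..n. q j * var j)"
  proof -
    have "(\<Sum>j=1..n. q j * var j) = (\<Sum>j=1..n. \<Sum>t\<in>{t \<in> Poly_Mapping.keys p. \<sigma> t = j}. Poly_Mapping.single t (Poly_Mapping.lookup p t))"
    proof (rule sum.cong)
      fix j
      have "Poly_Mapping.single (r t) (Poly_Mapping.lookup p t) * var j = Poly_Mapping.single t (Poly_Mapping.lookup p t)"
        if "t \<in> Poly_Mapping.keys p" "\<sigma> t = j" for t
        using r[OF that(1)] that(2) by (simp add: var_def mult_single)
      thus "q j * var j = (\<Sum>t\<in>{t \<in> Poly_Mapping.keys p. \<sigma> t = j}. Poly_Mapping.single t (Poly_Mapping.lookup p t))"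
        unfolding q_def sum_distrib_right by (intro sum.cong) auto
    qed simp
    also have "\<dots> = (\<Sum>t\<in>Poly_Mapping.keys p. Poly_Mapping.single t (Poly_Mapping.lookup p t))"
      by (rule sum.group) (use \<sigma> in auto)
    finally show ?thesis by (simp flip: sum_single_keys)
  qed
  moreover have "form e (q j)" if "form (Suc e) p" for e j
    unfolding form_def
  proof
    fix s assume "s \<in> Poly_Mapping.keys (q j)"
    then obtain t where t: "t \<in> Poly_Mapping.keys p" "s = r t" using keys_q by blast
    thus "mon_degree s = e"
      using that arg_cong[OF r[OF t(1)], of mon_degree] by (auto simp: mon_degree_add form_def)
  qed
  ultimately show thesis using that by blast
qed

text \<open>With \<open>decompose_wrt_vars\<close> this makes membership in an ideal generated by
  variables a condition on single monomials.\<close>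

lemma key_of_var_combination:
  assumes "t \<in> Poly_Mapping.keys (\<Sum>j=1..n. a j * var j)"
  shows "\<exists>j\<in>{1..n}. j \<in> Poly_Mapping.keys t"
proof -
  obtain j where "j \<in> {1..n}" "t \<in> Poly_Mapping.keys (a j * var j)"
    using assms by (rule keys_sumE)
  moreover from this(2) obtain s where "t = s + Poly_Mapping.single j 1" by (rule keys_mult_varE)
  ultimately show ?thesis by (intro bexI[of _ j]) (auto simp: in_keys_iff lookup_add)
qed

text \<open>Reduces minimality to the positive degree of the matrix entries.\<close>

lemma form_in_irrelevant_ideal:
  fixes p :: "'k::field mpoly"
  assumes p: "p \<in> carrier (poly_ring m)" "form e p" and "e \<ge> 1"
  shows "p \<in> Idl\<^bsub>poly_ring m\<^esub> (var ` {1..m})"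
proof -
  have "\<forall>t\<in>Poly_Mapping.keys p. \<exists>j\<in>{1..m}. j \<in> Poly_Mapping.keys t"
  proof
    fix t assume t: "t \<in> Poly_Mapping.keys p"
    hence "mon_degree t \<noteq> 0" using assms by (auto simp: form_def)
    hence "Poly_Mapping.keys t \<noteq> {}" by (auto simp: mon_degree_def)
    thus "\<exists>j\<in>{1..m}. j \<in> Poly_Mapping.keys t"
      using p(1) t unfolding carrier_poly_ring by blast
  qed
  from p(1) this obtain q where q: "\<forall>j. q j \<in> carrier (poly_ring m)" "p = (\<Sum>j=1..m. q j * var j)"
    by (rule decompose_wrt_vars)
  hence "p = (\<Sum>j\<in>{1..m}. var j * restrict q {1..m} j)" by (simp add: mult.commute)
  moreover have "restrict q {1..m} \<in> {1..m} \<rightarrow>\<^sub>E carrier (poly_ring m)" using q by auto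
  ultimately have "p \<in> (\<lambda>c. \<Sum>i\<in>{1..m}. var i * c i) ` ({1..m} \<rightarrow>\<^sub>E carrier (poly_ring m))"
    by (rule image_eqI)
  thus ?thesis by (subst genideal_finite_family) (auto intro: carrier_var)
qed


section \<open>Exactness of the Koszul complex\<close>

definition koszul_sign :: "nat \<Rightarrow> nat set \<Rightarrow> 'k::field mpoly"
  where "koszul_sign j T = (-1) ^ card {l \<in> T. j < l}"

text \<open>The Koszul differential in all homological degrees at once, read off at
  \<open>e_T\<close>, which receives contributions from the sets \<open>insert j T\<close>. Total
  functions on sets avoid carrying cardinalities and domains along.\<close>

definition koszul_d :: "nat \<Rightarrow> (nat set \<Rightarrow> 'k::field mpoly) \<Rightarrow> nat set \<Rightarrow> 'k mpoly"
  where "koszul_d n v T = (\<Sum>j\<in>{1..n} - T. koszul_sign j T * var j * v (insert j T))"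

lemma koszul_d_cong:
  "(\<And>j. j \<in> {1..n} \<Longrightarrow> j \<notin> T \<Longrightarrow> v (insert j T) = w (insert j T)) \<Longrightarrow> koszul_d n v T = koszul_d n w T"
  unfolding koszul_d_def by (intro sum.cong) auto

lemma koszul_d_add: "koszul_d n (\<lambda>S. v S + w S) T = koszul_d n v T + koszul_d n w T"
  by (simp add: koszul_d_def distrib_left sum.distrib)

lemma koszul_d_cmult: "koszul_d n (\<lambda>S. c * v S) T = c * koszul_d n v T"
  by (simp add: koszul_d_def sum_distrib_left mult_ac)

lemma koszul_d_uminus: "koszul_d n (\<lambda>S. - v S) T = - koszul_d n v T"
  by (simp add: koszul_d_def sum_negf)

text \<open>First component of the mapping cone differential for multiplication by
  \<open>x_(n+1)\<close>. No element of \<open>T\<close> exceeds \<open>Suc n\<close>, hence the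
  sign +1.\<close>

lemma koszul_d_Suc:
  assumes "T \<subseteq> {1..n}"
  shows "koszul_d (Suc n) v T = koszul_d n v T + var (Suc n) * v (insert (Suc n) T)"
proof -
  have "{1..Suc n} - T = insert (Suc n) ({1..n} - T)" using assms by auto
  moreover have "koszul_sign (Suc n) T = (1 :: 'a mpoly)"
  proof -
    have "{l \<in> T. Suc n < l} = {}" using assms by auto
    thus ?thesis unfolding koszul_sign_def by (metis card.empty power_0)
  qed
  ultimately show ?thesis by (simp add: koszul_d_def add.commute)
qed

text \<open>Second component of the cone differential: the largest index is counted once more in
  every sign.\<close>

lemma koszul_d_Suc_insert:
  assumes "T \<subseteq> {1..n}"
  shows "koszul_d (Suc n) v (insert (Suc n) T) = - koszul_d n (\<lambda>S. v (insert (Suc n) S)) T"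
proof -
  have "{1..Suc n} - insert (Suc n) T = {1..n} - T" by auto
  moreover have "koszul_sign j (insert (Suc n) T) = - (koszul_sign j T :: 'a mpoly)" if "j \<in> {1..n}" for j
  proof -
    have "{l \<in> insert (Suc n) T. j < l} = insert (Suc n) {l \<in> T. j < l}" using that by auto
    moreover have "finite T" "Suc n \<notin> T" using assms finite_subset by auto
    ultimately show ?thesis unfolding koszul_sign_def by simp
  qed
  ultimately show ?thesis
    by (simp add: koszul_d_def sum_negf insert_commute[of "Suc n"] flip: sum_negf)
qed

text \<open>By the cone formulas, with \<open>x\<close> the new variable and \<open>b\<close> the
  part on sets containing it, the mixed terms \<open>x d b\<close> and \<open>- x d b\<close>
  cancel.\<close>

lemma koszul_d_d: "T \<subseteq> {1..n} \<Longrightarrow> koszul_d n (koszul_d n w) T = 0"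
proof (induction n arbitrary: T w)
  case 0
  thus ?case by (simp add: koszul_d_def)
next
  case (Suc n)
  let ?b = "\<lambda>S. w (insert (Suc n) S)"
  show ?case
  proof (cases "Suc n \<in> T")
    case False
    hence T: "T \<subseteq> {1..n}" using Suc.prems by (force simp: subset_iff le_Suc_eq)
    have "koszul_d n (koszul_d (Suc n) w) T = koszul_d n (\<lambda>S. koszul_d n w S + var (Suc n) * ?b S) T"
      by (rule koszul_d_cong, rule koszul_d_Suc) (use T in auto)
    thus ?thesis
      using Suc.IH[OF T] by (simp add: koszul_d_Suc[OF T] koszul_d_Suc_insert[OF T] koszul_d_add koszul_d_cmult)
  next
    case True
    define T' where "T' = T - {Suc n}"
    have T: "T' \<subseteq> {1..n}" "T = insert (Suc n) T'"
      using Suc.prems True by (auto simp: T'_def subset_iff le_Suc_eq)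
    have "koszul_d n (\<lambda>S. koszul_d (Suc n) w (insert (Suc n) S)) T' = koszul_d n (\<lambda>S. - koszul_d n ?b S) T'"
      by (rule koszul_d_cong, rule koszul_d_Suc_insert) (use T in auto)
    thus ?thesis
      using Suc.IH[OF T(1)] by (simp add: T(2) koszul_d_Suc_insert[OF T(1)] koszul_d_uminus)
  qed
qed

text \<open>The case \<open>i = 1\<close> of the mapping cone argument: \<open>x\<^bsub>n+1\<^esub>\<close> is a nonzerodivisor modulo
  \<open>(x\<^sub>1, \<dots>, x\<^sub>n)\<close>.\<close>

lemma var_colon:
  fixes b :: "'k::field mpoly"
  assumes b: "b \<in> carrier (poly_ring m)" and eq: "var (Suc n) * b = (\<Sum>j=1..n. a j * var j)"
  shows "\<exists>q. (\<forall>j. q j \<in> carrier (poly_ring m)) \<and> b = (\<Sum>j=1..n. q j * var j)"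
proof -
  have "\<forall>t\<in>Poly_Mapping.keys b. \<exists>j\<in>{1..n}. j \<in> Poly_Mapping.keys t"
  proof
    fix t assume "t \<in> Poly_Mapping.keys b"
    hence "Poly_Mapping.single (Suc n) 1 + t \<in> Poly_Mapping.keys (var (Suc n) * b)"
      by (simp add: var_def in_keys_iff lookup_single_mult)
    \<comment> \<open>As \<open>j\<close> differs from \<open>Suc n\<close>, it must already occur
      in \<open>t\<close>.\<close>
    then obtain j where "j \<in> {1..n}" "j \<in> Poly_Mapping.keys (Poly_Mapping.single (Suc n) 1 + t)"
      unfolding eq using key_of_var_combination by blast
    thus "\<exists>j\<in>{1..n}. j \<in> Poly_Mapping.keys t"
      by (intro bexI[of _ j]) (auto simp: in_keys_iff lookup_add lookup_single)
  qed
  from decompose_wrt_vars[OF b this] show ?thesis by metis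
qed

lemma koszul_d_empty: "koszul_d n v {} = (\<Sum>j=1..n. v {j} * var j)"
  by (simp add: koszul_d_def koszul_sign_def mult.commute)

text \<open>Split a cycle into the part \<open>a\<close> on sets avoiding \<open>Suc n\<close> and
  the part \<open>b\<close> on the others. The cone formulas give \<open>d b = 0\<close> and
  \<open>d a + x b = 0\<close>. Once \<open>b = d c\<close>, the chain \<open>a + x c\<close> is a
  cycle, hence some \<open>d e\<close>, and the pair \<open>(e, - c)\<close> bounds
  \<open>(a, b)\<close>.\<close>

lemma koszul_exact:
  fixes v :: "nat set \<Rightarrow> 'k::field mpoly"
  assumes "n \<le> m" "i \<ge> 1"
    and "\<And>S. S \<subseteq> {1..n} \<Longrightarrow> card S = i \<Longrightarrow> v S \<in> carrier (poly_ring m)"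
    and "\<And>T. T \<subseteq> {1..n} \<Longrightarrow> card T = i - 1 \<Longrightarrow> koszul_d n v T = 0"
  shows "\<exists>w. (\<forall>S. w S \<in> carrier (poly_ring m)) \<and>
    (\<forall>S. S \<subseteq> {1..n} \<longrightarrow> card S = i \<longrightarrow> v S = koszul_d n w S)"
  using assms
proof (induction n arbitrary: i v)
  case 0
  thus ?case by (intro exI[of _ "\<lambda>_. 0"]) auto
next
  case (Suc n)
  let ?R = "carrier (poly_ring m) :: 'k mpoly set"
  let ?x = "var (Suc n) :: 'k mpoly"
  define b where "b = (\<lambda>T. v (insert (Suc n) T))"
  have card_ins: "card (insert (Suc n) T) = Suc (card T)" if "T \<subseteq> {1..n}" for T
    using that by (subst card_insert_disjoint) (auto intro: finite_subset)
  have x: "?x \<in> ?R" using Suc.prems by (auto intro: carrier_var)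
  have bR: "b T \<in> ?R" if "T \<subseteq> {1..n}" "card T = i - 1" for T
    unfolding b_def using that Suc.prems(2) card_ins[OF that(1)] by (intro Suc.prems(3)) auto
  have vb: "koszul_d n v T + ?x * b T = 0" if "T \<subseteq> {1..n}" "card T = i - 1" for T
    unfolding b_def using that Suc.prems(4)[of T] koszul_d_Suc[OF that(1), of v] by force
  have "\<exists>c. (\<forall>S. c S \<in> ?R) \<and> (\<forall>T. T \<subseteq> {1..n} \<longrightarrow> card T = i - 1 \<longrightarrow> b T = koszul_d n c T)"
  proof (cases "i = 1")
    \<comment> \<open>Now \<open>b\<close> is a single polynomial in homological degree 0, where the
      Koszul complex is not exact; the relation \<open>d a + x b = 0\<close> supplies what the
      induction hypothesis cannot.\<close>
    case True
    have b0: "b {} \<in> ?R" using bR[of "{}"] True by simp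
    have eq0: "?x * b {} = (\<Sum>j=1..n. (- v {j}) * var j)"
    proof -
      have "(\<Sum>j=1..n. v {j} * var j) + ?x * b {} = 0"
        using vb[of "{}"] True unfolding koszul_d_empty by simp
      thus ?thesis unfolding mult_minus_left sum_negf by (rule add.inverse_unique[symmetric])
    qed
    obtain q where q: "\<forall>j. q j \<in> ?R" "b {} = (\<Sum>j=1..n. q j * var j)"
      using var_colon[OF b0 eq0] by (elim exE conjE)
    have "b T = koszul_d n (\<lambda>S. q (the_elem S)) T" if "T \<subseteq> {1..n}" "card T = i - 1" for T
    proof -
      have "T = {}" using that True finite_subset[OF that(1)] by simp
      thus ?thesis using q by (simp add: koszul_d_empty)
    qed
    thus ?thesis using q by (intro exI[of _ "\<lambda>S. q (the_elem S)"]) auto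
  next
    case False
    show ?thesis
    proof (rule Suc.IH)
      fix T assume T: "T \<subseteq> {1..n}" "card T = i - 1 - 1"
      have "koszul_d (Suc n) v (insert (Suc n) T) = 0"
        using T False Suc.prems(2) card_ins[OF T(1)] by (intro Suc.prems(4)) auto
      thus "koszul_d n b T = 0" by (simp add: koszul_d_Suc_insert[OF T(1)] b_def)
    qed (use Suc.prems False bR in auto)
  qed
  then obtain c where c: "\<And>S. c S \<in> ?R"
    "\<And>T. T \<subseteq> {1..n} \<Longrightarrow> card T = i - 1 \<Longrightarrow> b T = koszul_d n c T" by blast
  have "\<exists>e. (\<forall>S. e S \<in> ?R) \<and>
    (\<forall>S. S \<subseteq> {1..n} \<longrightarrow> card S = i \<longrightarrow> v S + ?x * c S = koszul_d n e S)"
  proof (rule Suc.IH)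
    fix T assume "T \<subseteq> {1..n}" "card T = i - 1"
    thus "koszul_d n (\<lambda>S. v S + ?x * c S) T = 0"
      using vb[of T] c(2)[of T] by (simp add: koszul_d_add koszul_d_cmult)
  next
    fix S assume S: "S \<subseteq> {1..n}" "card S = i"
    have "v S \<in> ?R" using S by (intro Suc.prems(3)) auto
    thus "v S + ?x * c S \<in> ?R" using c x by auto
  qed (use Suc.prems in auto)
  then obtain e where e: "\<And>S. e S \<in> ?R"
    "\<And>S. S \<subseteq> {1..n} \<Longrightarrow> card S = i \<Longrightarrow> v S + ?x * c S = koszul_d n e S" by blast
  define w where "w = (\<lambda>S. if Suc n \<in> S then - c (S - {Suc n}) else e S)"
  have w_e: "koszul_d n w T = koszul_d n e T" if "T \<subseteq> {1..n}" for T
    by (rule koszul_d_cong) (use that in \<open>auto simp: w_def\<close>)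
  have w_c: "w (insert (Suc n) T) = - c T" if "T \<subseteq> {1..n}" for T
  proof -
    have "insert (Suc n) T - {Suc n} = T" using that by auto
    thus ?thesis by (simp add: w_def)
  qed
  have "v S = koszul_d (Suc n) w S" if S: "S \<subseteq> {1..Suc n}" "card S = i" for S
  proof (cases "Suc n \<in> S")
    case False
    hence S': "S \<subseteq> {1..n}" using S by (force simp: subset_iff le_Suc_eq)
    have "v S = koszul_d n e S - ?x * c S" using e(2)[OF S' S(2)] by (simp flip: e(2)[OF S' S(2)])
    thus ?thesis by (simp add: koszul_d_Suc[OF S'] w_e[OF S'] w_c[OF S'])
  next
    case True
    define T where "T = S - {Suc n}"
    have T: "T \<subseteq> {1..n}" "S = insert (Suc n) T"
      using S True by (auto simp: T_def subset_iff le_Suc_eq)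
    have cT: "card T = i - 1" using card_ins[OF T(1)] T(2) S(2) by simp
    have "koszul_d n (\<lambda>S. w (insert (Suc n) S)) T = koszul_d n (\<lambda>S. - c S) T"
      by (rule koszul_d_cong, rule w_c) (use T in auto)
    thus ?thesis
      using c(2)[OF T(1) cT] by (simp add: T(2) koszul_d_Suc_insert[OF T(1)] koszul_d_uminus b_def)
  qed
  moreover have "w S \<in> ?R" for S using c e by (auto simp: w_def)
  ultimately show ?case by blast
qed

text \<open>Only the columns \<open>S = insert j T\<close> contribute to row \<open>T\<close>, so
  pairs of a column and a removed index are reindexed by \<open>j\<close>.\<close>

lemma koszul_mat_eq:
  assumes T: "T \<subseteq> {1..n}"
  shows "(\<Sum>S | S \<subseteq> {1..n} \<and> card S = Suc (card T). koszul_mat T S * v S) = koszul_d n v T"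
proof -
  have fin: "finite S" if "S \<subseteq> {1..n}" for S using that finite_subset by blast
  have "(\<Sum>S | S \<subseteq> {1..n} \<and> card S = Suc (card T). koszul_mat T S * v S) =
    (\<Sum>(S, j)\<in>(SIGMA S:{S. S \<subseteq> {1..n} \<and> card S = Suc (card T)}. {j. j \<in> S \<and> T = S - {j}}).
       (-1) ^ card {l\<in>S. j < l} * var j * v S)"
    by (subst sum.Sigma[symmetric]) (auto simp: koszul_mat_def sum_distrib_right fin)
  also have "\<dots> = koszul_d n v T"
    unfolding koszul_d_def
  proof (rule sum.reindex_bij_witness[where i = "\<lambda>j. (insert j T, j)" and j = snd])
    fix j assume j: "j \<in> {1..n} - T"
    show "(insert j T, j) \<in> (SIGMA S:{S. S \<subseteq> {1..n} \<and> card S = Suc (card T)}. {j. j \<in> S \<and> T = S - {j}})"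
      using j T fin[OF T] by auto
  next
    fix a assume "a \<in> (SIGMA S:{S. S \<subseteq> {1..n} \<and> card S = Suc (card T)}. {j. j \<in> S \<and> T = S - {j}})"
    then obtain S j where a: "a = (S, j)" "S \<subseteq> {1..n}" "j \<in> S" "T = S - {j}" by auto
    hence S: "S = insert j T" by auto
    have "{l \<in> insert j T. j < l} = {l \<in> T. j < l}" by auto
    thus "koszul_sign (snd a) T * var (snd a) * v (insert (snd a) T) =
        (case a of (S, j) \<Rightarrow> (-1) ^ card {l\<in>S. j < l} * var j * v S)"
      using a(1) S by (simp add: koszul_sign_def)
  qed auto
  finally show ?thesis .
qed


section \<open>The resolution\<close>

lemma form_0 [simp]: "form e 0"
  by (simp add: form_def)

lemma form_uminus: "form e p \<Longrightarrow> form e (- p)"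
  by (simp add: form_def keys_uminus)

lemma form_sum: "(\<And>i. i \<in> I \<Longrightarrow> form e (h i)) \<Longrightarrow> form e (sum h I)"
  unfolding form_def by (blast elim: keys_sumE)

lemma form_mult:
  assumes "form a p" "form b q"
  shows "form (a + b) (p * q)"
  unfolding form_def
proof
  fix t assume "t \<in> Poly_Mapping.keys (p * q)"
  then obtain s u where "t = s + u" "s \<in> Poly_Mapping.keys p" "u \<in> Poly_Mapping.keys q"
    using keys_mult[of p q] by blast
  thus "mon_degree t = a + b" using assms by (simp add: form_def mon_degree_add)
qed

lemma form_var: "form 1 (var i)"
  by (simp add: form_def var_def)

lemma form_sign: "form 0 ((- 1 :: 'k::field mpoly) ^ j)"
proof (induction j)
  case (Suc j)
  have "form 0 (- 1 :: 'k mpoly)" by (rule form_uminus) (simp add: form_def mon_degree_def)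
  thus ?case using form_mult[OF _ Suc, of 0 "- 1"] by simp
qed (simp add: form_def mon_degree_def)

lemma form_koszul_mat: "form 1 (koszul_mat T S :: 'k::field mpoly)"
  unfolding koszul_mat_def using form_mult[OF form_sign form_var] by (intro form_sum) simp

lemma koszul_mat_carrier:
  assumes "S \<subseteq> {1..n}" "n \<le> m"
  shows "koszul_mat T S \<in> carrier (poly_ring m)"
  unfolding koszul_mat_def using assms
  by (intro carrier_sum carrier_mult carrier_power carrier_uminus carrier_1 carrier_var) auto

text \<open>The coefficients provided by ideal membership need not be homogeneous; they only show
  which monomials occur in \<open>g\<close>, and these are then distributed anew.\<close>

lemma expression_exists:
  fixes g :: "'k::field mpoly"
  assumes "g \<in> carrier (poly_ring (n + 1))" "form d g" "d \<ge> 1"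
    and "g \<in> Idl\<^bsub>poly_ring (n + 1)\<^esub> (var ` {1..n})"
  shows "\<exists>q. is_expression n d g q"
proof -
  obtain a where "g = (\<Sum>j\<in>{1..n}. var j * a j)"
    using assms(4) by (subst (asm) genideal_finite_family) (auto intro: carrier_var)
  hence "g = (\<Sum>j=1..n. a j * var j)" by (simp add: mult.commute)
  hence "\<forall>t\<in>Poly_Mapping.keys g. \<exists>j\<in>{1..n}. j \<in> Poly_Mapping.keys t"
    using key_of_var_combination[of _ a n] by simp
  from assms(1) this obtain q where q: "\<forall>j. q j \<in> carrier (poly_ring (n + 1))" "g = (\<Sum>j=1..n. q j * var j)"
    "\<forall>e j. form (Suc e) g \<longrightarrow> form e (q j)"
    by (rule decompose_wrt_vars)
  have "form (d - 1) (q j)" for j using q(3)[rule_format, of "d - 1"] assms by simp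
  thus ?thesis using q by (auto simp: is_expression_def)
qed

text \<open>If \<open>f = 0\<close>, every divisor of \<open>g\<close> is a common divisor:
  \<open>g\<close> itself, or \<open>x_1\<close> in case \<open>g = 0\<close>, would be a unit,
  though it is a form of positive degree.\<close>

lemma relatively_prime_nonzero:
  fixes f g :: "'k::field mpoly"
  assumes "relatively_prime (poly_ring m) f g" "f \<in> carrier (poly_ring m)" "g \<in> carrier (poly_ring m)"
    and "form e g" "e \<ge> 1" "m \<ge> 1"
  shows "f \<noteq> 0"
proof
  assume "f = 0"
  have not_unit: "c \<notin> Units (poly_ring m)" if c: "form e c" "e \<ge> 1" for c :: "'k mpoly" and e
  proof
    assume "c \<in> Units (poly_ring m)"
    then obtain b where "c * b = 1" by (auto simp: Units_def)
    hence "0 \<in> Poly_Mapping.keys (c * b)" by simp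
    then obtain s t where "0 = s + t" "s \<in> Poly_Mapping.keys c"
      using keys_mult[of c b] by blast
    hence "mon_degree (s + t) = 0" "mon_degree s = e"
      using c by (auto simp: form_def simp flip: \<open>0 = s + t\<close>) (simp add: mon_degree_def)
    thus False using c by (simp add: mon_degree_add)
  qed
  show False
  proof (cases "g = 0")
    case True
    have "var 1 \<in> carrier (poly_ring m :: 'k mpoly ring)"
      using assms(6) by (intro carrier_var) simp
    hence "var 1 \<in> Units (poly_ring m :: 'k mpoly ring)"
      using assms True \<open>f = 0\<close> by (simp add: relatively_prime_def divides_poly_ring)
    thus False using not_unit[OF form_var] by simp
  next
    case False
    have "g \<in> Units (poly_ring m)"
      using assms \<open>f = 0\<close> by (simp add: relatively_prime_def divides_poly_ring)
    thus False using not_unit assms by blast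
  qed
qed

locale resolution_setup =
  fixes n d :: nat and f g :: "'k::field mpoly" and q :: "nat \<Rightarrow> 'k mpoly"
  assumes d: "d \<ge> 2"
    and f: "f \<in> carrier (poly_ring (n + 1))" "form (d - 1) f"
    and g: "g \<in> carrier (poly_ring (n + 1))" "form d g"
    and coprime: "relatively_prime (poly_ring (n + 1)) f g"
    and expression: "is_expression n d g q"
begin

abbreviation "R \<equiv> carrier (poly_ring (n + 1)) :: 'k mpoly set"
abbreviation "C \<equiv> res_complex n d f g q"
abbreviation "K i \<equiv> {S. S \<subseteq> {1..n} \<and> card S = i}"

lemma q: "i \<in> {1..n} \<Longrightarrow> q i \<in> R" "i \<in> {1..n} \<Longrightarrow> form (d - 1) (q i)"
  and g_eq: "g = (\<Sum>i=1..n. q i * var i)"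
  using expression by (auto simp: is_expression_def)

lemma f_nonzero: "f \<noteq> 0"
  using relatively_prime_nonzero[OF coprime f(1) g] d by simp

section \<open>Bases of the free modules\<close>

lemma finite_K [simp]: "finite (K i)"
  by (rule finite_subset[of _ "Pow {1..n}"]) auto

lemma K_0: "K 0 = {{}}"
  by (auto dest: finite_subset)

lemma K_1: "K 1 = (\<lambda>j. {j}) ` {1..n}"
  by (auto simp: card_1_singleton_iff)

lemma gens_C: "gens C i = Some ` K i \<union> (if i \<in> {1, 2} then {None} else {})"
  by (simp add: res_complex_def)

lemma gens_C_0: "gens C 0 = {Some {}}"
  using K_0 by (simp add: gens_C)

lemma sum_gens:
  "(\<Sum>b\<in>gens C i. h b) = (\<Sum>S\<in>K i. h (Some S)) + (if i \<in> {1, 2} then h None else 0)"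
proof -
  have "(\<Sum>b\<in>gens C i. h b) = (\<Sum>b\<in>Some ` K i. h b) + (\<Sum>b\<in>(if i \<in> {1, 2} then {None} else {}). h b)"
    unfolding gens_C by (rule sum.union_disjoint) auto
  thus ?thesis by (simp add: sum.reindex)
qed

section \<open>The differentials expressed through \<open>koszul_d\<close>\<close>

lemma dmat_C: "dmat C i = (if i = 1 then gen_row f g else if i = 2 then psi f q else tail_mat)"
  by (simp add: res_complex_def)

lemma dmap_C: "a \<in> gens C (i - 1) \<Longrightarrow> dmap C i v a = (\<Sum>b\<in>gens C i. dmat C i a b * v b)"
  by (simp add: dmap_def)

lemma dmap_1: "dmap C 1 v (Some {}) = f * koszul_d n (\<lambda>S. v (Some S)) {} + g * v None"
proof -
  have "(\<Sum>S\<in>K 1. var (the_elem S) * f * v (Some S)) = f * koszul_d n (\<lambda>S. v (Some S)) {}"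
    unfolding K_1 by (subst sum.reindex) (auto simp: koszul_d_empty sum_distrib_left mult_ac)
  thus ?thesis by (subst dmap_C) (auto simp: gens_C_0 sum_gens dmat_C gen_row_def)
qed

lemma dmap_2_Some:
  assumes "T \<in> K 1"
  shows "dmap C 2 v (Some T) = koszul_d n (\<lambda>S. v (Some S)) T - q (the_elem T) * v None"
  using koszul_mat_eq[of T n "\<lambda>S. v (Some S)"] assms
  by (subst dmap_C) (auto simp: gens_C[of "Suc 0"] sum_gens dmat_C psi_def numeral_2_eq_2)

lemma dmap_2_None: "dmap C 2 v None = f * v None"
  by (subst dmap_C) (auto simp: gens_C[of "Suc 0"] sum_gens dmat_C psi_def)

lemma dmap_tail_Some:
  assumes "T \<in> K i" "i \<ge> 2"
  shows "dmap C (Suc i) v (Some T) = koszul_d n (\<lambda>S. v (Some S)) T"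
  using koszul_mat_eq[of T n "\<lambda>S. v (Some S)"] assms
  by (subst dmap_C) (auto simp: gens_C[of i] sum_gens dmat_C tail_mat_def)

lemma dmap_tail_None: "dmap C 3 v None = 0"
  by (subst dmap_C) (auto simp: gens_C[of 2] sum_gens dmat_C tail_mat_def)

lemma dmap_undefined: "a \<notin> gens C (i - 1) \<Longrightarrow> dmap C i v a = undefined"
  by (simp add: dmap_def)

lemma dker_iff:
  "v \<in> dker m C i \<longleftrightarrow> v \<in> free_mod m C i \<and> (\<forall>a\<in>gens C (i - 1). dmap C i v a = 0)"
  unfolding dker_def dmap_def by (auto simp: fun_eq_iff restrict_def)

lemma free_mod_iff:
  "v \<in> free_mod m C i \<longleftrightarrow>
    (\<forall>b\<in>gens C i. v b \<in> carrier (poly_ring m)) \<and> (\<forall>b. b \<notin> gens C i \<longrightarrow> v b = undefined)"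
  by (auto simp: free_mod_def PiE_iff extensional_def)

text \<open>The strict inequality is more than gradedness asks for: nonzero entries have positive
  degree, which is minimality.\<close>

lemma entries:
  assumes "i \<ge> 1" "a \<in> gens C (i - 1)" "b \<in> gens C i"
  shows "dmat C i a b \<in> R \<and> (dmat C i a b = 0 \<or>
    gdeg C (i - 1) a < gdeg C i b \<and> form (gdeg C i b - gdeg C (i - 1) a) (dmat C i a b))"
proof -
  consider "i = 1" | "i = 2" | "i \<ge> 3" using assms(1) by linarith
  thus ?thesis
  proof cases
    case 1
    have a: "a = Some {}" using 1 assms(2) by (simp add: gens_C_0)
    show ?thesis
    proof (cases b)
      case None
      thus ?thesis using 1 a g d by (simp add: dmat_C gen_row_def res_complex_def)
    next
      case (Some S)
      hence "S \<in> K 1" using 1 assms(3) by (auto simp: gens_C)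
      then obtain j where j: "S = {j}" "j \<in> {1..n}" unfolding K_1 by blast
      have "form (1 + (d - 1)) (var j * f)" by (rule form_mult[OF form_var f(2)])
      moreover have "var j * f \<in> R" using j f by (intro carrier_mult carrier_var) auto
      ultimately show ?thesis
        using 1 a j Some d by (simp add: dmat_C gen_row_def res_complex_def)
    qed
  next
    case 2
    show ?thesis
    proof (cases b)
      case None
      show ?thesis
      proof (cases a)
        case None
        \<comment> \<open>The entry \<open>f\<close> has degree \<open>d - 1\<close>, which is
          positive because \<open>d \<ge> 2\<close>.\<close>
        have "d < 2 * d - 1" "2 * d - 1 - d = d - 1" using d by linarith+
        thus ?thesis using 2 None \<open>b = None\<close> f by (simp add: dmat_C psi_def res_complex_def)
      next
        case (Some T)
        hence "T \<in> K 1" using 2 assms(2) by (auto simp: gens_C)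
        then obtain j where j: "T = {j}" "j \<in> {1..n}" unfolding K_1 by blast
        thus ?thesis using 2 None Some d q[OF j(2)] form_uminus[OF q(2)[OF j(2)]]
          by (auto simp: dmat_C psi_def res_complex_def)
      qed
    next
      case (Some S)
      hence "S \<subseteq> {1..n}" using assms(3) by (auto simp: gens_C split: if_splits)
      thus ?thesis
        using 2 Some d koszul_mat_carrier[of S n "n + 1"] form_koszul_mat[where 'k = 'k]
        by (cases a) (auto simp: dmat_C psi_def res_complex_def)
    qed
  next
    case 3
    then obtain S where S: "b = Some S" "S \<subseteq> {1..n}" using assms(3) by (auto simp: gens_C)
    show ?thesis
    proof (cases a)
      case None
      thus ?thesis using 3 by (simp add: dmat_C tail_mat_def)
    next
      case (Some T)
      have "d - 1 + i - (d - 1 + (i - 1)) = 1" using 3 by simp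
      thus ?thesis
        using 3 Some S koszul_mat_carrier[of S n "n + 1"] form_koszul_mat[where 'k = 'k]
        by (auto simp: dmat_C tail_mat_def res_complex_def)
    qed
  qed
qed

lemma graded: "graded_free_complex (n + 1) C"
  unfolding graded_free_complex_def
proof (intro conjI allI impI ballI)
  show "finite (gens C i)" for i by (simp add: gens_C)
  fix i a b assume "i \<ge> 1" "a \<in> gens C (i - 1)" "b \<in> gens C i"
  from entries[OF this] show "dmat C i a b \<in> R" "dmat C i a b = 0 \<or>
    gdeg C (i - 1) a \<le> gdeg C i b \<and> form (gdeg C i b - gdeg C (i - 1) a) (dmat C i a b)"
    by (blast intro: less_imp_le)+
qed

lemma minimal:
  assumes "i \<ge> 1" "a \<in> gens C (i - 1)" "b \<in> gens C i"
  shows "dmat C i a b \<in> Idl\<^bsub>poly_ring (n + 1)\<^esub> (var ` {1..n + 1})"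
proof (cases "dmat C i a b = 0")
  case True
  thus ?thesis using form_in_irrelevant_ideal[of 0 "n + 1" 1] by simp
next
  case False
  thus ?thesis using entries[OF assms]
    by (intro form_in_irrelevant_ideal[where e = "gdeg C i b - gdeg C (i - 1) a"]) auto
qed

lemma augmentation:
  "(\<lambda>v. dmap C 1 v (Some {})) ` free_mod (n + 1) C 1 =
     Idl\<^bsub>poly_ring (n + 1)\<^esub> ((\<lambda>i. var i * f) ` {1..n} \<union> {g})"
proof -
  have "gen_row f g (Some {}) ` gens C 1 = (\<lambda>i. var i * f) ` {1..n} \<union> {g}"
    unfolding gens_C K_1 by (auto simp: gen_row_def image_Un image_image)
  moreover have "gen_row f g (Some {}) b \<in> R" if "b \<in> gens C 1" for b
    using entries[of 1 "Some {}" b] that by (simp add: gens_C_0 dmat_C)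
  moreover have "finite (gens C 1)" by (simp add: gens_C)
  ultimately show ?thesis
    using genideal_finite_family[of "gens C 1" "gen_row f g (Some {})" "n + 1"]
    by (simp add: free_mod_def dmap_C gens_C_0 dmat_C cong: image_cong_simp)
qed

lemma exact_1: "dker (n + 1) C 1 = dmap C 2 ` free_mod (n + 1) C 2"
proof (intro subset_antisym subsetI)
  fix v assume "v \<in> dker (n + 1) C 1"
  hence v: "v \<in> free_mod (n + 1) C 1" and eq: "dmap C 1 v (Some {}) = 0"
    by (auto simp: dker_iff gens_C_0)
  have vR: "v None \<in> R" "\<And>S. S \<in> K 1 \<Longrightarrow> v (Some S) \<in> R"
    using v by (auto simp: free_mod_iff gens_C)
  have eq: "f * koszul_d n (\<lambda>S. v (Some S)) {} + g * v None = 0" using eq unfolding dmap_1 .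
  hence "v None * g = f * (- koszul_d n (\<lambda>S. v (Some S)) {})"
    by (simp add: add_eq_0_iff2 mult.commute)
  hence "f dvd v None * g" by simp
  hence "f dvd v None"
    using relatively_prime_dvd_mult[OF coprime f_nonzero f(1) g(1) vR(1)] by simp
  then obtain w0 where w0: "v None = w0 * f" by (auto simp: dvd_def mult.commute)
  \<comment> \<open>The case distinction serves to show that \<open>w\<close> lies in
    \<open>R\<close>, as \<open>carrier_factor\<close> is about nonzero products.\<close>
  define w where "w = (if v None = 0 then 0 else w0)"
  have w: "v None = f * w" "w \<in> R"
    using w0 vR(1) carrier_factor[of w0 f "n + 1"] by (auto simp: w_def mult.commute)
  define u where "u = (\<lambda>S. v (Some S) + w * q (the_elem S))"
  have "f * (koszul_d n (\<lambda>S. v (Some S)) {} + w * g) = 0" using eq w(1) by (simp add: algebra_simps)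
  hence "koszul_d n (\<lambda>S. v (Some S)) {} + w * g = 0" using f_nonzero by simp
  hence u: "koszul_d n u {} = 0"
    by (simp add: u_def koszul_d_add koszul_d_cmult) (simp add: koszul_d_empty g_eq)
  have "\<exists>z. (\<forall>S. z S \<in> R) \<and> (\<forall>S. S \<subseteq> {1..n} \<longrightarrow> card S = 1 \<longrightarrow> u S = koszul_d n z S)"
  proof (rule koszul_exact)
    fix S assume "S \<subseteq> {1..n}" "card S = 1"
    hence S: "S \<in> K 1" by simp
    then obtain j where "S = {j}" "j \<in> {1..n}" unfolding K_1 by blast
    thus "u S \<in> R" using vR(2)[OF S] w(2) q(1) by (auto simp: u_def)
  next
    fix T assume "T \<subseteq> {1..n}" "card T = 1 - 1"
    hence "T \<in> K 0" by simp
    thus "koszul_d n u T = 0" using u unfolding K_0 by simp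
  qed auto
  then obtain z where z: "\<And>S. z S \<in> R" "\<And>S. S \<in> K 1 \<Longrightarrow> u S = koszul_d n z S" by blast
  define Z where "Z = (\<lambda>b\<in>gens C 2. case b of Some S \<Rightarrow> z S | None \<Rightarrow> w)"
  have "Z \<in> free_mod (n + 1) C 2" using z w by (auto simp: free_mod_iff Z_def gens_C)
  moreover have "v = dmap C 2 Z"
  proof
    fix a
    consider "a \<notin> gens C 1" | "a = None" | T where "a = Some T" "T \<in> K 1" by (auto simp: gens_C)
    thus "v a = dmap C 2 Z a"
    proof cases
      case 1
      thus ?thesis using v dmap_undefined[of a 2 Z] by (simp add: free_mod_iff)
    next
      case 2
      thus ?thesis using w by (simp add: dmap_2_None Z_def gens_C)
    next
      case (3 T)
      have "koszul_d n (\<lambda>S. Z (Some S)) T = koszul_d n z T"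
      proof (rule koszul_d_cong)
        fix j assume "j \<in> {1..n}" "j \<notin> T"
        thus "Z (Some (insert j T)) = z (insert j T)"
          using 3 finite_subset[of T "{1..n}"] by (simp add: Z_def gens_C image_iff)
      qed
      hence "dmap C 2 Z (Some T) = u T - q (the_elem T) * w"
        using 3 z(2) by (simp add: dmap_2_Some Z_def gens_C)
      thus ?thesis using 3 by (simp add: u_def)
    qed
  qed
  ultimately show "v \<in> dmap C 2 ` free_mod (n + 1) C 2" by blast
next
  fix v assume "v \<in> dmap C 2 ` free_mod (n + 1) C 2"
  then obtain w where w: "w \<in> free_mod (n + 1) C 2" and v: "v = dmap C 2 w" by blast
  have wR: "w b \<in> R" if "b \<in> gens C 2" for b using w that by (auto simp: free_mod_iff)
  have "v b \<in> R" if "b \<in> gens C 1" for b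
    using that entries[of 2 b] wR by (auto simp: v dmap_C intro!: carrier_sum carrier_mult)
  hence "v \<in> free_mod (n + 1) C 1" by (auto simp: free_mod_iff v dmap_undefined)
  moreover have "dmap C 1 v (Some {}) = 0"
  proof -
    let ?W = "\<lambda>S. w (Some S)"
    \<comment> \<open>The Koszul columns contribute nothing since the differential squares to 0. The
      last column contributes \<open>- g\<close> times its coefficient, which after multiplication
      by \<open>f\<close> cancels against \<open>g\<close> times the last entry.\<close>
    have "koszul_d n (\<lambda>S. v (Some S)) {} =
        koszul_d n (\<lambda>S. koszul_d n ?W S + (- w None) * q (the_elem S)) {}"
      by (rule koszul_d_cong) (simp add: v dmap_2_Some mult.commute)
    also have "\<dots> = koszul_d n (koszul_d n ?W) {} + (- w None) * koszul_d n (\<lambda>S. q (the_elem S)) {}"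
      by (simp only: koszul_d_add koszul_d_cmult)
    also have "\<dots> = - w None * g"
      using koszul_d_d[of "{}" n ?W] by (simp add: koszul_d_empty[of n "\<lambda>S. q (the_elem S)"] g_eq)
    finally show ?thesis unfolding dmap_1 by (simp add: v dmap_2_None)
  qed
  ultimately show "v \<in> dker (n + 1) C 1" by (simp add: dker_iff gens_C_0)
qed

text \<open>The extra generator in homological degree 2 is invisible to the homology: its coordinate
  vanishes on cycles because \<open>f\<close> is nonzero, and on boundaries because row
  \<open>None\<close> of the third differential is 0. What remains is the Koszul complex.\<close>

lemma exact_tail:
  assumes i: "i \<ge> 2"
  shows "dker (n + 1) C i = dmap C (Suc i) ` free_mod (n + 1) C (Suc i)"
proof (intro subset_antisym subsetI)
  fix v assume "v \<in> dker (n + 1) C i"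
  hence v: "v \<in> free_mod (n + 1) C i" and eq: "\<And>a. a \<in> gens C (i - 1) \<Longrightarrow> dmap C i v a = 0"
    by (auto simp: dker_iff)
  have None: "v None = 0" if "i = 2"
    using eq[of None] that f_nonzero by (simp add: gens_C dmap_2_None)
  have "\<exists>z. (\<forall>S. z S \<in> R) \<and> (\<forall>S. S \<subseteq> {1..n} \<longrightarrow> card S = i \<longrightarrow> v (Some S) = koszul_d n z S)"
  proof (rule koszul_exact)
    fix S assume "S \<subseteq> {1..n}" "card S = i"
    thus "v (Some S) \<in> R" using v by (auto simp: free_mod_iff gens_C)
  next
    fix T assume T: "T \<subseteq> {1..n}" "card T = i - 1"
    hence "Some T \<in> gens C (i - 1)" by (simp add: gens_C image_iff)
    hence 0: "dmap C i v (Some T) = 0" by (rule eq)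
    show "koszul_d n (\<lambda>S. v (Some S)) T = 0"
    proof (cases "i = 2")
      case True
      thus ?thesis using 0 T None by (simp add: dmap_2_Some)
    next
      case False
      thus ?thesis using 0 T i dmap_tail_Some[of T "i - 1" v] by simp
    qed
  qed (use i in auto)
  then obtain z where z: "\<And>S. z S \<in> R" "\<And>S. S \<in> K i \<Longrightarrow> v (Some S) = koszul_d n z S" by blast
  \<comment> \<open>\<open>the\<close> is only applied to values of \<open>Some\<close>, as
    \<open>Suc i \<ge> 3\<close> leaves no generator \<open>None\<close>.\<close>
  define Z where "Z = (\<lambda>b\<in>gens C (Suc i). z (the b))"
  have "Z \<in> free_mod (n + 1) C (Suc i)" using z by (auto simp: free_mod_iff Z_def)
  moreover have "v = dmap C (Suc i) Z"
  proof
    fix a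
    consider "a \<notin> gens C i" | "a = None" "i = 2" | T where "a = Some T" "T \<in> K i"
      using i by (cases "i = 2") (auto simp: gens_C)
    thus "v a = dmap C (Suc i) Z a"
    proof cases
      case 1
      thus ?thesis using v dmap_undefined[of a "Suc i" Z] by (simp add: free_mod_iff)
    next
      case 2
      thus ?thesis using None dmap_tail_None[of Z] by (simp add: numeral_3_eq_3 numeral_2_eq_2)
    next
      case (3 T)
      have "koszul_d n (\<lambda>S. Z (Some S)) T = koszul_d n z T"
      proof (rule koszul_d_cong)
        fix j assume "j \<in> {1..n}" "j \<notin> T"
        thus "Z (Some (insert j T)) = z (insert j T)"
          using 3 finite_subset[of T "{1..n}"] by (simp add: Z_def gens_C image_iff)
      qed
      thus ?thesis using 3 z(2) dmap_tail_Some[OF 3(2) i] by simp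
    qed
  qed
  ultimately show "v \<in> dmap C (Suc i) ` free_mod (n + 1) C (Suc i)" by blast
next
  fix v assume "v \<in> dmap C (Suc i) ` free_mod (n + 1) C (Suc i)"
  then obtain w where w: "w \<in> free_mod (n + 1) C (Suc i)" and v: "v = dmap C (Suc i) w" by blast
  have wR: "w b \<in> R" if "b \<in> gens C (Suc i)" for b using w that by (auto simp: free_mod_iff)
  have "v b \<in> R" if "b \<in> gens C i" for b
    using that entries[of "Suc i" b] wR by (auto simp: v dmap_C intro!: carrier_sum carrier_mult)
  hence "v \<in> free_mod (n + 1) C i" by (auto simp: free_mod_iff v dmap_undefined)
  moreover have "dmap C i v a = 0" if a: "a \<in> gens C (i - 1)" for a
  proof -
    have None: "v None = 0" if "i = 2"
      using dmap_tail_None[of w] that by (simp add: v numeral_3_eq_3 numeral_2_eq_2)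
    have dd: "koszul_d n (\<lambda>S. v (Some S)) T = 0" if T: "T \<in> K (i - 1)" for T
    proof -
      have "koszul_d n (\<lambda>S. v (Some S)) T = koszul_d n (koszul_d n (\<lambda>S. w (Some S))) T"
      proof (rule koszul_d_cong)
        fix j assume "j \<in> {1..n}" "j \<notin> T"
        hence "insert j T \<in> K i" using T i finite_subset[of T "{1..n}"] by simp
        thus "v (Some (insert j T)) = koszul_d n (\<lambda>S. w (Some S)) (insert j T)"
          by (simp add: v dmap_tail_Some[OF _ i])
      qed
      thus ?thesis using T koszul_d_d[of T n "\<lambda>S. w (Some S)"] by simp
    qed
    \<comment> \<open>The row \<open>None\<close> is present exactly when \<open>i - 1\<close> is 1
      or 2; for \<open>i = 3\<close> it consists of zeros.\<close>
    consider "a = None" "i = 2" | "a = None" "i = 3" | T where "a = Some T" "T \<in> K (i - 1)" "i = 2"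
      | T where "a = Some T" "T \<in> K (i - 1)" "i \<ge> 3"
      using a i by (fastforce simp: gens_C split: if_splits)
    thus ?thesis
    proof cases
      case 1
      thus ?thesis using None by (simp add: dmap_2_None)
    next
      case 2
      thus ?thesis by (simp add: dmap_tail_None)
    next
      case (3 T)
      thus ?thesis using None dd[of T] by (simp add: dmap_2_Some)
    next
      case (4 T)
      thus ?thesis using dd[of T] dmap_tail_Some[of T "i - 1" v] by simp
    qed
  qed
  ultimately show "v \<in> dker (n + 1) C i" by (simp add: dker_iff)
qed

lemma minimal_resolution:
  "minimal_graded_free_resolution (n + 1)
     (Idl\<^bsub>poly_ring (n + 1)\<^esub> ((\<lambda>i. var i * f) ` {1..n} \<union> {g})) C"
  unfolding minimal_graded_free_resolution_def
proof (intro conjI)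
  show "\<exists>e. gens C 0 = {e} \<and> gdeg C 0 e = 0 \<and> (\<lambda>v. dmap C 1 v e) ` free_mod (n + 1) C 1 =
      Idl\<^bsub>poly_ring (n + 1)\<^esub> ((\<lambda>i. var i * f) ` {1..n} \<union> {g})"
    using augmentation by (intro exI[of _ "Some {}"] conjI gens_C_0) (simp add: res_complex_def)
  show "\<forall>i\<ge>1. dker (n + 1) C i = dmap C (i + 1) ` free_mod (n + 1) C (i + 1)"
  proof (intro allI impI)
    fix i :: nat assume "i \<ge> 1"
    then consider "i = 1" | "i \<ge> 2" by linarith
    thus "dker (n + 1) C i = dmap C (i + 1) ` free_mod (n + 1) C (i + 1)"
    proof cases
      case 1
      have "i + 1 = 2" using 1 by simp
      thus ?thesis using exact_1 1 by metis
    next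
      case 2
      thus ?thesis using exact_tail[of i] by simp
    qed
  qed
qed (use graded minimal in auto)

section \<open>Degrees of the basis elements\<close>

lemma card_K: "card (K i) = n choose i"
  using n_subsets[of "{1..n}" i] by simp

lemma gen_degrees_C:
  "gen_degrees C i = replicate_mset (n choose i) (if i = 0 then 0 else d - 1 + i) +
     (if i = 1 then {#d#} else if i = 2 then {#2 * d - 1#} else {#})"
proof -
  have "mset_set (gens C i) = mset_set (Some ` K i) + mset_set (if i \<in> {1, 2} then {None} else {})"
    unfolding gens_C by (rule mset_set_Union) auto
  also have "image_mset (gdeg C i) (mset_set (Some ` K i)) =
      image_mset (\<lambda>_. if i = 0 then 0 else d - 1 + i) (mset_set (Some ` K i))"
    by (rule image_mset_cong) (auto simp: res_complex_def)
  hence "image_mset (gdeg C i) (mset_set (Some ` K i)) =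
      replicate_mset (n choose i) (if i = 0 then 0 else d - 1 + i)"
    by (simp only: image_mset_const_eq size_mset_set card_image inj_Some card_K)
  ultimately show ?thesis
    unfolding gen_degrees_def by (simp add: res_complex_def)
qed

end

theorem proposition2p1:
  fixes n d :: nat and f g :: "'k::field mpoly"
  assumes "n \<ge> 2"
    and "infinite (UNIV :: 'k set)"
    and "d \<ge> 2"
    and "f \<in> carrier (poly_ring (n + 1))" and "form (d - 1) f"
    and "g \<in> carrier (poly_ring (n + 1))" and "form d g"
    and "relatively_prime (poly_ring (n + 1)) f g"
    and "g \<in> Idl\<^bsub>poly_ring (n + 1)\<^esub> (var ` {1..n})"
  shows "(\<exists>q. is_expression n d g q) \<and>
    (\<forall>q. is_expression n d g q \<longrightarrow>
      (let C = res_complex n d f g q; K = koszul n :: (nat set, 'k mpoly) free_complex in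
        minimal_graded_free_resolution (n + 1)
          (Idl\<^bsub>poly_ring (n + 1)\<^esub> ((\<lambda>i. var i * f) ` {1..n} \<union> {g})) C \<and>
        gen_degrees C 0 = {#0#} \<and>
        gen_degrees C 1 = replicate_mset (n + 1) d \<and>
        gen_degrees C 2 = replicate_mset (n choose 2) (d + 1) + {#2 * d - 1#} \<and>
        (\<forall>i\<in>{3..n}. gen_degrees C i = replicate_mset (n choose i) (d - 1 + i)) \<and>
        (\<forall>i>n. i \<ge> 3 \<longrightarrow> gens C i = {}) \<and>
        dmat C 2 = psi f q \<and>
        (\<forall>i\<in>{3..n}. gens C i = Some ` gens K i \<and>
          (\<forall>S\<in>gens K i. gdeg C i (Some S) = gdeg K i S + (d - 1)) \<and>
          (\<forall>S\<in>gens K i. \<forall>T\<in>gens K (i - 1). dmat C i (Some T) (Some S) = dmat K i T S))))"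
proof (intro conjI allI impI)
  show "\<exists>q. is_expression n d g q"
    using assms by (intro expression_exists) auto
next
  fix q assume "is_expression n d g q"
  then interpret resolution_setup n d f g q
    using assms by unfold_locales
  have 0: "gen_degrees C 0 = {#0#}" using gen_degrees_C[of 0] by simp
  \<comment> \<open>The \<open>n\<close> products \<open>x_i f\<close> and the form \<open>g\<close>
    share the degree \<open>d\<close>, so the two summands merge.\<close>
  have 1: "gen_degrees C 1 = replicate_mset (n + 1) d" using gen_degrees_C[of 1] d by simp
  have "d - 1 + 2 = d + 1" using d by simp
  hence 2: "gen_degrees C 2 = replicate_mset (n choose 2) (d + 1) + {#2 * d - 1#}"
    using gen_degrees_C[of 2] by simp
  have 3: "\<forall>i\<in>{3..n}. gen_degrees C i = replicate_mset (n choose i) (d - 1 + i)"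
  proof
    fix i assume "i \<in> {3..n}"
    thus "gen_degrees C i = replicate_mset (n choose i) (d - 1 + i)"
      using gen_degrees_C[of i] by simp
  qed
  have 4: "\<forall>i>n. i \<ge> 3 \<longrightarrow> gens C i = {}"
  proof (intro allI impI)
    fix i :: nat assume i: "i > n" "i \<ge> 3"
    have "card (K i) = 0" unfolding card_K using i(1) by (rule binomial_eq_0)
    hence "K i = {}" by (simp only: card_0_eq[OF finite_K])
    moreover have "i \<notin> {1, 2}" using i(2) by simp
    ultimately show "gens C i = {}" unfolding gens_C by (simp only: image_empty if_False Un_empty)
  qed
  have 5: "\<forall>i\<in>{3..n}. gens C i = Some ` gens (koszul n :: (nat set, 'k mpoly) free_complex) i \<and>
      (\<forall>S\<in>gens (koszul n :: (nat set, 'k mpoly) free_complex) i.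
        gdeg C i (Some S) = gdeg (koszul n :: (nat set, 'k mpoly) free_complex) i S + (d - 1)) \<and>
      (\<forall>S\<in>gens (koszul n :: (nat set, 'k mpoly) free_complex) i.
        \<forall>T\<in>gens (koszul n :: (nat set, 'k mpoly) free_complex) (i - 1).
          dmat C i (Some T) (Some S) = dmat (koszul n) i T S)"
    by (simp add: koszul_def res_complex_def tail_mat_def)
  have 6: "dmat C 2 = psi f q" by (simp add: dmat_C)
  show "let C = res_complex n d f g q; K = koszul n :: (nat set, 'k mpoly) free_complex in
        minimal_graded_free_resolution (n + 1)
          (Idl\<^bsub>poly_ring (n + 1)\<^esub> ((\<lambda>i. var i * f) ` {1..n} \<union> {g})) C \<and>
        gen_degrees C 0 = {#0#} \<and>
        gen_degrees C 1 = replicate_mset (n + 1) d \<and>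
        gen_degrees C 2 = replicate_mset (n choose 2) (d + 1) + {#2 * d - 1#} \<and>
        (\<forall>i\<in>{3..n}. gen_degrees C i = replicate_mset (n choose i) (d - 1 + i)) \<and>
        (\<forall>i>n. i \<ge> 3 \<longrightarrow> gens C i = {}) \<and>
        dmat C 2 = psi f q \<and>
        (\<forall>i\<in>{3..n}. gens C i = Some ` gens K i \<and>
          (\<forall>S\<in>gens K i. gdeg C i (Some S) = gdeg K i S + (d - 1)) \<and>
          (\<forall>S\<in>gens K i. \<forall>T\<in>gens K (i - 1). dmat C i (Some T) (Some S) = dmat K i T S))"
    unfolding Let_def using minimal_resolution 0 1 2 3 4 6 5 by (intro conjI)
qed

end
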